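(* For every integer $d\ge 2$ one has $c_{d,3}=c_{2,3}$. Moreover, $1.11767\le c_{d,3}\le 3.14626$ for every $d\geq 2$.
   Context: Notation: $\mathbb{B}^d$ is the open unit Euclidean ball in $\mathbb{C}^d$; $\|\cdot\|$ is the operator norm on $n\times n$ complex matrices acting on the Hilbert space $\mathbb{C}^n$ with its Euclidean norm. A $d$-tuple $T=(T_1,\dots,T_d)$ of $n\times n$ complex matrices is commuting if $T_iT_j=T_jT_i$ for all $i,j$, and row contractive if $\sum_{j=1}^d T_jT_j^*\le I$ (i.e. $I-\sum_{j=1}^d T_jT_j^*$ is positive semidefinite), where $I$ is the identity matrix and $T_j^*$ is the adjoint of $T_j$. For integers $d,n\ge 2$, $c_{d,n}\ge 0$ denotes the smallest constant such that for every commuting, row contractive $d$-tuple $T$ of $n\times n$ complex matrices and every polynomial $p\in\mathbb{C}[z_1,\dots,z_d]$, $$\|p(T)\|\le c_{d,n}\sup_{z\in\mathbb{B}^d}|p(z)|.$$ (The existence of such a smallest finite constant is a known theorem of Hartz, Richter and Shalit.) *)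

theory Defs
  imports "HOL-Analysis.Analysis" "HOL-Library.Poly_Mapping"
begin

text \<open>
  The number of variables d is a natural number, and the matrix size n is the cardinality of
  the index type. A d-tuple is a function on \<^typ>\<open>nat\<close> of which only the values at
  indices below d are ever used.
\<close>

definition ctranspose :: "complex^'n^'m \<Rightarrow> complex^'m^'n" where
  "ctranspose A = (\<chi> i j. cnj (A $ j $ i))"

definition psd :: "complex^'n^'n \<Rightarrow> bool" where
  "psd A \<longleftrightarrow> (\<forall>x. (\<Sum>i\<in>UNIV. cnj (x $ i) * (A *v x) $ i) \<in> \<real>\<^sub>\<ge>\<^sub>0)"

definition commuting_tuple :: "nat \<Rightarrow> (nat \<Rightarrow> complex^'n^'n) \<Rightarrow> bool" where
  "commuting_tuple d T \<longleftrightarrow> (\<forall>i<d. \<forall>j<d. T i ** T j = T j ** T i)"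

definition row_contractive :: "nat \<Rightarrow> (nat \<Rightarrow> complex^'n^'n) \<Rightarrow> bool" where
  "row_contractive d T \<longleftrightarrow> psd (mat 1 - (\<Sum>j<d. T j ** ctranspose (T j)))"

text \<open>
  A polynomial is a finitely supported map from exponents to coefficients, an exponent being
  in turn a finitely supported map from variables to powers.
\<close>

type_synonym cpoly = "(nat \<Rightarrow>\<^sub>0 nat) \<Rightarrow>\<^sub>0 complex"

definition polys :: "nat \<Rightarrow> cpoly set" where
  "polys d = {p. \<forall>m \<in> Poly_Mapping.keys p. Poly_Mapping.keys m \<subseteq> {..<d}}"

definition poly_at :: "nat \<Rightarrow> cpoly \<Rightarrow> (nat \<Rightarrow> complex) \<Rightarrow> complex" where
  "poly_at d p z = (\<Sum>m\<in>Poly_Mapping.keys p.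
     Poly_Mapping.lookup p m * (\<Prod>i<d. z i ^ Poly_Mapping.lookup m i))"

text \<open>
  On the type of square matrices the library's \<open>*\<close> and \<open>^\<close> act entrywise, so powers
  with respect to the matrix product need their own definition.
\<close>

primrec mpow :: "complex^'n^'n \<Rightarrow> nat \<Rightarrow> complex^'n^'n" where
  "mpow A 0 = mat 1"
| "mpow A (Suc k) = A ** mpow A k"

text \<open>
  The monomial with exponent m at T is the ordered product of the powers of
  T 0, ..., T (d - 1); the order is immaterial for commuting tuples.
\<close>

definition monom_at_mats :: "nat \<Rightarrow> (nat \<Rightarrow>\<^sub>0 nat) \<Rightarrow> (nat \<Rightarrow> complex^'n^'n) \<Rightarrow> complex^'n^'n" where
  "monom_at_mats d m T = foldr (\<lambda>i M. mpow (T i) (Poly_Mapping.lookup m i) ** M) [0..<d] (mat 1)"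

definition poly_at_mats :: "nat \<Rightarrow> cpoly \<Rightarrow> (nat \<Rightarrow> complex^'n^'n) \<Rightarrow> complex^'n^'n" where
  "poly_at_mats d p T = (\<Sum>m\<in>Poly_Mapping.keys p.
     mat (Poly_Mapping.lookup p m) ** monom_at_mats d m T)"

definition opnorm :: "complex^'n^'n \<Rightarrow> real" where
  "opnorm A = onorm (\<lambda>x. A *v x)"

definition unit_ball :: "nat \<Rightarrow> (nat \<Rightarrow> complex) set" where
  "unit_ball d = {z. (\<Sum>i<d. (cmod (z i))\<^sup>2) < 1}"

definition ball_sup :: "nat \<Rightarrow> cpoly \<Rightarrow> real" where
  "ball_sup d p = (SUP z\<in>unit_ball d. cmod (poly_at d p z))"

definition vN_bound :: "nat \<Rightarrow> 'n::finite itself \<Rightarrow> real \<Rightarrow> bool" where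
  "vN_bound d _ C \<longleftrightarrow>
     (\<forall>T :: nat \<Rightarrow> complex^'n^'n. commuting_tuple d T \<and> row_contractive d T \<longrightarrow>
        (\<forall>p\<in>polys d. opnorm (poly_at_mats d p T) \<le> C * ball_sup d p))"

definition vN_const :: "nat \<Rightarrow> 'n::finite itself \<Rightarrow> real" where
  "vN_const d N = (LEAST C. 0 \<le> C \<and> vN_bound d N C)"

end

theory Submission
  imports Defs "HOL-Complex_Analysis.Conformal_Mappings"
begin

text \<open>
  Bounds of von Neumann type are insensitive to holomorphic changes of variables: if a polynomial
  map sends one ball into another, then composing with it does not increase suprema, so a bound for
  a tuple passes to the image of the tuple (\<open>satisfies_vN_polynomial_image\<close>), and unitary
  similarity and limits do no harm either. For \<open>3 \<times> 3\<close> matrices these moves suffice to normalize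
  every commuting row contraction.

  A commuting tuple is unitarily equivalent to an upper triangular one
  (\<open>unitary_triangularization\<close>). The automorphism of the ball that sends the tuple of middle
  diagonal entries to \<open>0\<close> makes these entries vanish (\<open>satisfies_vN_moebius\<close>). Commutativity
  then leaves so little room that the matrices span a space of dimension at most \<open>2\<close>
  (\<open>two_dimensional_span\<close>), and an isometric change of variables replaces the tuple by a pair
  \<open>R\<^sub>0, R\<^sub>1\<close> (\<open>reduction_to_pairs\<close>). Hence the best constant does not depend on \<open>d\<close>.

  The pair can be chosen such that only the first row of \<open>R\<^sub>1\<close> is nonzero. The first basis vector is
  a joint eigenvector, say with eigenvalues \<open>a, b\<close>. Writing
  \<open>p(z, w) = p(z, 0) + w q(z, w)\<close> gives \<open>p(R) = p(R\<^sub>0, 0) + q(a, b) R\<^sub>1\<close>. By von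
  Neumann's inequality the first summand has norm at most \<open>sup \<bar>p\<bar>\<close>. With
  \<open>t = sqrt (1 - \<bar>a\<bar>\<^sup>2)\<close> the maximum principle on the disc of radius \<open>t\<close> gives
  \<open>\<bar>q(a, b)\<bar> \<le> 2 sup \<bar>p\<bar> / t\<close>, while row contractivity, tested on the first basis vector, gives
  \<open>\<parallel>R\<^sub>1\<parallel> \<le> t\<close> and disposes of the case \<open>t = 0\<close>. So the constant is at most \<open>3\<close> (\<open>satisfies_vN_rank_one_row\<close>).

  A nilpotent pair and the polynomial \<open>16/25 z\<^sup>2 + 24/25 w\<close> show that the constant is at least
  \<open>1.152\<close> (\<open>vN_bound_lower\<close>).
\<close>

section \<open>The Hermitian inner product and matrices\<close>

definition hdot :: "complex^'n \<Rightarrow> complex^'n \<Rightarrow> complex" where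
  "hdot x y = (\<Sum>i\<in>UNIV. cnj (x $ i) * y $ i)"

lemma hdot_add: "hdot (x + y) z = hdot x z + hdot y z" "hdot z (x + y) = hdot z x + hdot z y"
  by (simp_all add: hdot_def algebra_simps sum.distrib)

lemma hdot_diff: "hdot (x - y) z = hdot x z - hdot y z" "hdot z (x - y) = hdot z x - hdot z y"
  by (simp_all add: hdot_def algebra_simps sum_subtractf)

lemma hdot_scale: "hdot (c *s x) y = cnj c * hdot x y" "hdot x (c *s y) = c * hdot x y"
  by (simp_all add: hdot_def algebra_simps sum_distrib_left)

lemma hdot_0 [simp]: "hdot 0 x = 0" "hdot x 0 = 0"
  by (simp_all add: hdot_def)

lemma hdot_sum: "hdot (\<Sum>j\<in>J. f j) z = (\<Sum>j\<in>J. hdot (f j) z)"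
    "hdot z (\<Sum>j\<in>J. f j) = (\<Sum>j\<in>J. hdot z (f j))"
  by (induction J rule: infinite_finite_induct) (simp_all add: hdot_add)

lemma cnj_hdot: "cnj (hdot x y) = hdot y x"
  by (simp add: hdot_def mult.commute)

lemma Re_hdot: "Re (hdot x y) = x \<bullet> y"
  by (simp add: hdot_def inner_vec_def inner_complex_def)

lemma hdot_self: "hdot x x = of_real ((norm x)\<^sup>2)"
proof -
  have "Im (hdot x x) = 0"
    by (simp add: hdot_def)
  then show ?thesis
    by (simp add: complex_eq_iff Re_hdot power2_norm_eq_inner)
qed

lemma ctranspose_ctranspose [simp]: "ctranspose (ctranspose A) = A"
  by (simp add: ctranspose_def vec_eq_iff)

lemma ctranspose_mult: "ctranspose (A ** B) = ctranspose B ** ctranspose A"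
  by (simp add: ctranspose_def vec_eq_iff matrix_matrix_mult_def mult.commute)

lemma ctranspose_nth [simp]: "ctranspose A $ i $ j = cnj (A $ j $ i)"
  by (simp add: ctranspose_def)

lemma ctranspose_mat [simp]: "ctranspose (mat c) = mat (cnj c)"
  by (auto simp add: vec_eq_iff mat_def)

lemma hdot_ctranspose: "hdot (ctranspose A *v x) y = hdot x (A *v y)"
proof -
  have "hdot (ctranspose A *v x) y = (\<Sum>i\<in>UNIV. \<Sum>k\<in>UNIV. cnj (x $ k) * (A $ k $ i * y $ i))"
    by (simp add: hdot_def matrix_vector_mult_def sum_distrib_left algebra_simps)
  also have "\<dots> = (\<Sum>k\<in>UNIV. \<Sum>i\<in>UNIV. cnj (x $ k) * (A $ k $ i * y $ i))"
    by (rule sum.swap)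
  finally show ?thesis
    by (simp add: hdot_def matrix_vector_mult_def sum_distrib_left)
qed

lemma hdot_ctranspose': "hdot x (ctranspose A *v y) = hdot (A *v x) y"
  using hdot_ctranspose[of "ctranspose A" x y] by simp

lemma mat_vector_mult: "mat c *v x = c *s x"
  by (auto simp add: vec_eq_iff matrix_vector_mult_def mat_def if_distrib if_distribR cong: if_cong)

lemma mat_matrix_mult_nth: "(mat c ** A) $ i $ j = c * A $ i $ j"
  by (auto simp add: matrix_matrix_mult_def mat_def if_distrib if_distribR cong: if_cong)

lemma matrix_mult_mat_nth: "(A ** mat c) $ i $ j = A $ i $ j * c"
  by (auto simp add: matrix_matrix_mult_def mat_def if_distrib if_distribR cong: if_cong)

lemma mat_commute: "mat c ** A = A ** mat (c::complex)"
  by (simp add: vec_eq_iff mat_matrix_mult_nth matrix_mult_mat_nth)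

lemma norm_scale: "norm (c *s (x::complex^'n)) = cmod c * norm x"
proof -
  have "of_real ((norm (c *s x))\<^sup>2) = (of_real ((cmod c * norm x)\<^sup>2) :: complex)"
    unfolding hdot_self[symmetric] hdot_scale
    using complex_norm_square[of c] by (simp add: hdot_self power_mult_distrib mult_ac)
  then have "(norm (c *s x))\<^sup>2 = (cmod c * norm x)\<^sup>2"
    by (simp only: of_real_eq_iff)
  then show ?thesis by simp
qed

lemma hdot_Cauchy_Schwarz: "cmod (hdot x y) \<le> norm x * norm y"
proof (cases "hdot x y = 0")
  case False
  define u where "u = cnj (hdot x y) / cmod (hdot x y)"
  have "complex_of_real (cmod (hdot x y)) = hdot x (u *s y)"
    using False complex_norm_square[of "hdot x y"]
    by (simp add: hdot_scale u_def field_simps power2_eq_square)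
  then have "cmod (hdot x y) = x \<bullet> (u *s y)"
    by (metis Re_complex_of_real Re_hdot)
  also have "\<dots> \<le> norm x * norm (u *s y)"
    by (rule norm_cauchy_schwarz)
  also have "norm (u *s y) = norm y"
    using False by (simp add: norm_scale u_def norm_divide)
  finally show ?thesis .
qed simp

lemma matrix_sum_mult: "(\<Sum>j\<in>J. F j) ** B = (\<Sum>j\<in>J. F j ** B)" for B :: "complex^'n^'n"
  by (induction J rule: infinite_finite_induct)
    (simp_all add: vec_eq_iff matrix_matrix_mult_def algebra_simps sum.distrib)

lemma matrix_mult_sum_right: "B ** (\<Sum>j\<in>J. F j) = (\<Sum>j\<in>J. B ** F j)" for B :: "complex^'n^'n"
  by (induction J rule: infinite_finite_induct)
    (simp_all add: vec_eq_iff matrix_matrix_mult_def algebra_simps sum.distrib)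

lemma sum_matrix_vector_mult: "(\<Sum>j\<in>J. F j) *v x = (\<Sum>j\<in>J. F j *v x)" for x :: "complex^'n"
  by (induction J rule: infinite_finite_induct) (simp_all add: matrix_vector_mult_add_rdistrib)

lemma matrix_vector_mult_sum: "A *v (\<Sum>j\<in>J. x j) = (\<Sum>j\<in>J. A *v x j)" for A :: "complex^'n^'n"
  by (induction J rule: infinite_finite_induct) (simp_all add: matrix_vector_right_distrib)

lemma complex_nonneg_Reals_of_real: "complex_of_real r \<in> \<real>\<^sub>\<ge>\<^sub>0 \<longleftrightarrow> 0 \<le> r"
  by (simp add: complex_nonneg_Reals_iff)

text \<open>
  That the column of adjoints is a contraction is the form in which row contractivity is used below:
  it lets the adjoints act on vectors and needs no square roots of matrices.
\<close>

lemma row_contractive_iff: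
  "row_contractive d T \<longleftrightarrow> (\<forall>x. (\<Sum>j<d. (norm (ctranspose (T j) *v x))\<^sup>2) \<le> (norm x)\<^sup>2)"
proof -
  have "hdot x ((mat 1 - (\<Sum>j<d. T j ** ctranspose (T j))) *v x)
      = of_real ((norm x)\<^sup>2 - (\<Sum>j<d. (norm (ctranspose (T j) *v x))\<^sup>2))" for x
  proof -
    have "hdot x ((T j ** ctranspose (T j)) *v x) = of_real ((norm (ctranspose (T j) *v x))\<^sup>2)" for j
      by (simp only: matrix_vector_mul_assoc[symmetric] hdot_ctranspose[symmetric] hdot_self)
    then show ?thesis
      by (simp add: matrix_vector_mult_diff_rdistrib hdot_diff sum_matrix_vector_mult hdot_sum hdot_self)
  qed
  then show ?thesis
    unfolding row_contractive_def psd_def hdot_def[symmetric]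
    by (simp add: complex_nonneg_Reals_of_real del: of_real_diff)
qed

lemma opnorm_le_iff: "opnorm A \<le> c \<longleftrightarrow> (\<forall>x. norm (A *v x) \<le> c * norm x)"
proof
  assume "opnorm A \<le> c"
  show "\<forall>x. norm (A *v x) \<le> c * norm x"
  proof
    fix x
    have "norm (A *v x) \<le> opnorm A * norm x"
      unfolding opnorm_def by (rule onorm) simp
    also have "\<dots> \<le> c * norm x"
      using \<open>opnorm A \<le> c\<close> by (rule mult_right_mono) simp
    finally show "norm (A *v x) \<le> c * norm x" .
  qed
next
  assume "\<forall>x. norm (A *v x) \<le> c * norm x"
  then show "opnorm A \<le> c"
    unfolding opnorm_def by (auto intro: onorm_le)
qed

lemma norm_matrix_vector_le: "norm (A *v x) \<le> opnorm A * norm x" for A :: "complex^'n^'n"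
  using opnorm_le_iff[of A "opnorm A"] by simp

lemma opnorm_le_hdot:
  assumes "\<And>x y. norm x = 1 \<Longrightarrow> norm y = 1 \<Longrightarrow> cmod (hdot y (A *v x)) \<le> c"
  shows "opnorm A \<le> c"
  unfolding opnorm_le_iff
proof
  fix x
  show "norm (A *v x) \<le> c * norm x"
  proof (cases "A *v x = 0 \<or> x = 0")
    case True
    have "norm (axis undefined 1 :: complex^'n) = 1"
      by simp
    from assms[OF this this] have "0 \<le> c"
      using norm_ge_zero order_trans by blast
    with True show ?thesis by auto
  next
    case False
    define nx ny where "nx = complex_of_real (norm x)" and "ny = complex_of_real (norm (A *v x))"
    have nz: "nx \<noteq> 0" "ny \<noteq> 0" using False by (auto simp: nx_def ny_def)
    have "cmod (hdot (inverse ny *s (A *v x)) (A *v (inverse nx *s x))) \<le> c"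
      using False by (intro assms) (auto simp: norm_scale nx_def ny_def norm_inverse)
    moreover have "hdot (inverse ny *s (A *v x)) (A *v (inverse nx *s x)) = ny / nx"
      using nz by (simp add: vector_scalar_commute hdot_scale hdot_self)
        (simp add: ny_def field_simps power2_eq_square)
    ultimately have "norm (A *v x) / norm x \<le> c"
      by (simp add: nx_def ny_def norm_divide)
    then show ?thesis using False by (simp add: field_simps)
  qed
qed

section \<open>Polynomials at points and at commuting matrices\<close>

lemma opnorm_le_limit:
  fixes B :: "complex^'n^'n"
  assumes "\<And>i j. (\<lambda>n. A n $ i $ j) \<longlonglongrightarrow> B $ i $ j" "\<And>n. opnorm (A n) \<le> c"
  shows "opnorm B \<le> c"
  unfolding opnorm_le_iff
proof
  fix x :: "complex^'n"
  have "(\<lambda>n. A n *v x) \<longlonglongrightarrow> B *v x"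
    by (intro vec_tendstoI) (auto simp: matrix_vector_mult_def intro!: tendsto_intros assms(1))
  then have "(\<lambda>n. norm (A n *v x)) \<longlonglongrightarrow> norm (B *v x)"
    by (rule tendsto_norm)
  then show "norm (B *v x) \<le> c * norm x"
    by (rule LIMSEQ_le_const2) (use assms(2) in \<open>auto simp: opnorm_le_iff\<close>)
qed

lemma tendsto_matrix_mult:
  assumes "A \<longlonglongrightarrow> B" "A' \<longlonglongrightarrow> B'"
  shows "(\<lambda>n. A n ** A' n) \<longlonglongrightarrow> B ** (B' :: complex^'n^'n)"
  by (intro vec_tendstoI)
    (auto simp: matrix_matrix_mult_def intro!: tendsto_intros tendsto_vec_nth assms)

lemma commuting_tupleD: "commuting_tuple d T \<Longrightarrow> i < d \<Longrightarrow> j < d \<Longrightarrow> T i ** T j = T j ** T i"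
  by (simp add: commuting_tuple_def)

lemma mpow_add: "mpow A (k + l) = mpow A k ** mpow A l"
  by (induction k) (simp_all add: matrix_mul_assoc)

lemma mpow_commute:
  assumes "A ** B = B ** A"
  shows "mpow A k ** B = B ** mpow A k"
proof (induction k)
  case (Suc k)
  have "mpow A (Suc k) ** B = A ** (B ** mpow A k)"
    using Suc by (simp add: matrix_mul_assoc[symmetric])
  then show ?case
    using assms by (simp add: matrix_mul_assoc)
qed simp

lemma mpow_mpow_commute:
  assumes "A ** B = B ** A"
  shows "mpow A k ** mpow B l = mpow B l ** mpow A k"
  using assms by (metis mpow_commute)

lemma ctranspose_mpow: "ctranspose (mpow A k) = mpow (ctranspose A) k"
proof (induction k)
  case (Suc k)
  then show ?case
    using mpow_commute[of "ctranspose A" "ctranspose A" k] by (simp add: ctranspose_mult)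
qed simp

text \<open>
  Relates a scalar and a matrix function that are induced by the same polynomial. The closure
  properties of this relation take the place of computations with coefficients.
\<close>

definition poly_eval_pair ::
  "nat \<Rightarrow> ((nat \<Rightarrow> complex) \<Rightarrow> complex) \<Rightarrow> ((nat \<Rightarrow> complex^'n^'n) \<Rightarrow> complex^'n^'n) \<Rightarrow> bool" where
  "poly_eval_pair d f F \<longleftrightarrow> (\<exists>p\<in>polys d. (\<forall>z. poly_at d p z = f z) \<and>
     (\<forall>T. commuting_tuple d T \<longrightarrow> poly_at_mats d p T = F T))"

lemma poly_at_superset:
  assumes "finite K" "Poly_Mapping.keys p \<subseteq> K"
  shows "poly_at d p z = (\<Sum>m\<in>K. Poly_Mapping.lookup p m * (\<Prod>i<d. z i ^ Poly_Mapping.lookup m i))"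
  unfolding poly_at_def using assms
  by (intro sum.mono_neutral_left) (auto simp: in_keys_iff)

lemma mat_add_mult: "mat (a + b) ** (A :: complex^'n^'n) = mat a ** A + mat b ** A"
  by (simp add: vec_eq_iff mat_matrix_mult_nth algebra_simps)

lemma mat_mult_mat_mult: "(mat a ** A) ** (mat b ** B) = mat (a * b) ** ((A :: complex^'n^'n) ** B)"
proof -
  have "(mat a ** A) ** (mat b ** B) = mat a ** (A ** mat b) ** B"
    by (simp add: matrix_mul_assoc)
  also have "\<dots> = (mat a ** mat b) ** A ** B"
    unfolding mat_commute[of b A, symmetric] by (simp only: matrix_mul_assoc)
  also have "mat a ** mat b = (mat (a * b) :: complex^'n^'n)"
    by (simp add: vec_eq_iff mat_matrix_mult_nth) (simp add: mat_def)
  finally show ?thesis by (simp add: matrix_mul_assoc)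
qed

lemma poly_at_mats_superset:
  assumes "finite K" "Poly_Mapping.keys p \<subseteq> K"
  shows "poly_at_mats d p T = (\<Sum>m\<in>K. mat (Poly_Mapping.lookup p m) ** monom_at_mats d m T)"
  unfolding poly_at_mats_def using assms
  by (intro sum.mono_neutral_left) (auto simp: in_keys_iff)

lemma poly_eval_pair_add:
  assumes "poly_eval_pair d f F" "poly_eval_pair d g G"
  shows "poly_eval_pair d (\<lambda>z. f z + g z) (\<lambda>T. F T + G T)"
proof -
  obtain p q where pq: "p \<in> polys d" "q \<in> polys d"
    "\<And>z. poly_at d p z = f z" "\<And>z. poly_at d q z = g z"
    "\<And>T. commuting_tuple d T \<Longrightarrow> poly_at_mats d p T = F T"
    "\<And>T. commuting_tuple d T \<Longrightarrow> poly_at_mats d q T = G T"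
    using assms unfolding poly_eval_pair_def by blast
  define K where "K = Poly_Mapping.keys p \<union> Poly_Mapping.keys q"
  have K: "finite K" "Poly_Mapping.keys p \<subseteq> K" "Poly_Mapping.keys q \<subseteq> K" "Poly_Mapping.keys (p + q) \<subseteq> K"
    using Poly_Mapping.keys_add[of p q] by (auto simp: K_def)
  have "p + q \<in> polys d"
    using pq(1,2) K(4) by (fastforce simp: polys_def K_def)
  moreover have "poly_at d (p + q) z = f z + g z" for z
    by (simp add: poly_at_superset[OF K(1)] K lookup_add algebra_simps sum.distrib flip: pq(3,4))
  moreover have "poly_at_mats d (p + q) T = F T + G T" if "commuting_tuple d T" for T
    using that by (simp add: poly_at_mats_superset[OF K(1)] K lookup_add mat_add_mult sum.distrib flip: pq(5,6))
  ultimately show ?thesis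
    unfolding poly_eval_pair_def by blast
qed

lemma poly_eval_pair_monom:
  assumes "Poly_Mapping.keys m \<subseteq> {..<d}"
  shows "poly_eval_pair d (\<lambda>z. c * (\<Prod>i<d. z i ^ Poly_Mapping.lookup m i)) (\<lambda>T. mat c ** monom_at_mats d m T)"
  unfolding poly_eval_pair_def
proof (intro bexI conjI allI impI)
  show "Poly_Mapping.single m c \<in> polys d"
    using assms by (auto simp: polys_def)
  have K: "finite {m}" "Poly_Mapping.keys (Poly_Mapping.single m c) \<subseteq> {m}"
    by auto
  show "poly_at d (Poly_Mapping.single m c) z = c * (\<Prod>i<d. z i ^ Poly_Mapping.lookup m i)" for z
    by (simp add: poly_at_superset[OF K])
  show "poly_at_mats d (Poly_Mapping.single m c) T = mat c ** monom_at_mats d m T" for T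
    by (simp add: poly_at_mats_superset[OF K])
qed

lemma monom_at_mats_zero: "monom_at_mats d 0 T = mat 1"
proof -
  have "foldr (\<lambda>i M. mpow (T i) (Poly_Mapping.lookup 0 i) ** M) xs (mat 1) = mat 1" for xs
    by (induction xs) auto
  then show ?thesis by (simp add: monom_at_mats_def)
qed

lemma poly_eval_pair_const: "poly_eval_pair d (\<lambda>z. c) (\<lambda>T. mat c)"
  using poly_eval_pair_monom[of 0 d c] by (simp add: monom_at_mats_zero)

lemma poly_eval_pair_sum:
  assumes "\<And>j. j \<in> J \<Longrightarrow> poly_eval_pair d (f j) (F j)"
  shows "poly_eval_pair d (\<lambda>z. \<Sum>j\<in>J. f j z) (\<lambda>T. \<Sum>j\<in>J. F j T)"
  using assms
proof (induction J rule: infinite_finite_induct)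
  case (insert x J)
  then show ?case using poly_eval_pair_add[of d "f x" "F x"] by simp
qed (use poly_eval_pair_const[of d 0] in simp_all)

text \<open>
  Commutativity of the tuple enters the evaluation only here: it makes the ordered products of powers
  multiplicative.
\<close>

lemma monom_at_mats_add:
  assumes "commuting_tuple d T"
  shows "monom_at_mats d (m + m') T = monom_at_mats d m T ** monom_at_mats d m' T"
proof -
  define fold where "fold m xs = foldr (\<lambda>i M. mpow (T i) (Poly_Mapping.lookup m i) ** M) xs (mat 1)"
    for m :: "nat \<Rightarrow>\<^sub>0 nat" and xs
  have comm: "mpow (T i) k ** fold m xs = fold m xs ** mpow (T i) k"
    if "i < d" "set xs \<subseteq> {..<d}" for i k m xs
    using that(2)
  proof (induction xs)
    case (Cons x xs)
    have "mpow (T i) k ** fold m (x # xs) = mpow (T i) k ** mpow (T x) (Poly_Mapping.lookup m x) ** fold m xs"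
      by (simp add: fold_def matrix_mul_assoc)
    also have "\<dots> = mpow (T x) (Poly_Mapping.lookup m x) ** (mpow (T i) k ** fold m xs)"
      using mpow_mpow_commute[OF commuting_tupleD[OF assms, of i x]] that Cons.prems
      by (simp add: matrix_mul_assoc)
    also have "\<dots> = fold m (x # xs) ** mpow (T i) k"
      using Cons by (simp add: fold_def matrix_mul_assoc)
    finally show ?case .
  qed (simp add: fold_def)
  have "fold (m + m') xs = fold m xs ** fold m' xs" if "set xs \<subseteq> {..<d}" for xs
    using that
  proof (induction xs)
    case (Cons x xs)
    have "fold (m + m') (x # xs) = mpow (T x) (Poly_Mapping.lookup m x) **
        (mpow (T x) (Poly_Mapping.lookup m' x) ** fold m xs) ** fold m' xs"
      using Cons by (simp add: fold_def lookup_add mpow_add matrix_mul_assoc)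
    also have "\<dots> = mpow (T x) (Poly_Mapping.lookup m x) **
        (fold m xs ** mpow (T x) (Poly_Mapping.lookup m' x)) ** fold m' xs"
      using comm[of x xs] Cons.prems by simp
    also have "\<dots> = fold m (x # xs) ** fold m' (x # xs)"
      by (simp add: fold_def matrix_mul_assoc)
    finally show ?case .
  qed (simp add: fold_def)
  from this[of "[0..<d]"] show ?thesis
    by (simp add: monom_at_mats_def fold_def lessThan_atLeast0)
qed

lemma poly_eval_pair_mult:
  fixes F G :: "(nat \<Rightarrow> complex^'n^'n) \<Rightarrow> complex^'n^'n"
  assumes "poly_eval_pair d f F" "poly_eval_pair d g G"
  shows "poly_eval_pair d (\<lambda>z. f z * g z) (\<lambda>T. F T ** G T)"
proof -
  obtain p where p: "p \<in> polys d" "\<forall>z. poly_at d p z = f z"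
    "\<forall>T. commuting_tuple d T \<longrightarrow> poly_at_mats d p T = F T"
    using assms(1) unfolding poly_eval_pair_def by blast
  obtain q where q: "q \<in> polys d" "\<forall>z. poly_at d q z = g z"
    "\<forall>T. commuting_tuple d T \<longrightarrow> poly_at_mats d q T = G T"
    using assms(2) unfolding poly_eval_pair_def by blast
  let ?z = "\<lambda>m z. \<Prod>i<d. z i ^ Poly_Mapping.lookup m i"
  have mono: "?z (m + m') z = ?z m z * ?z m' z" for m m' and z :: "nat \<Rightarrow> complex"
    by (simp add: lookup_add power_add prod.distrib)
  have pair: "poly_eval_pair d
    (\<lambda>z. \<Sum>m\<in>Poly_Mapping.keys p. \<Sum>m'\<in>Poly_Mapping.keys q.
      (Poly_Mapping.lookup p m * Poly_Mapping.lookup q m') * ?z (m + m') z)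
    (\<lambda>T. \<Sum>m\<in>Poly_Mapping.keys p. \<Sum>m'\<in>Poly_Mapping.keys q.
      mat (Poly_Mapping.lookup p m * Poly_Mapping.lookup q m') ** monom_at_mats d (m + m') (T :: nat \<Rightarrow> complex^'n^'n))"
  proof (intro poly_eval_pair_sum poly_eval_pair_monom)
    fix m m' assume "m \<in> Poly_Mapping.keys p" "m' \<in> Poly_Mapping.keys q"
    then have "Poly_Mapping.keys m \<subseteq> {..<d}" "Poly_Mapping.keys m' \<subseteq> {..<d}"
      using p(1) q(1) by (auto simp: polys_def)
    then show "Poly_Mapping.keys (m + m') \<subseteq> {..<d}"
      using Poly_Mapping.keys_add[of m m'] by blast
  qed
  have scalar: "(\<Sum>m\<in>Poly_Mapping.keys p. \<Sum>m'\<in>Poly_Mapping.keys q.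
      (Poly_Mapping.lookup p m * Poly_Mapping.lookup q m') * ?z (m + m') z) = f z * g z" for z
    unfolding p(2)[rule_format, symmetric] q(2)[rule_format, symmetric] poly_at_def sum_product mono
    by (simp add: mult_ac)
  have matrix: "(\<Sum>m\<in>Poly_Mapping.keys p. \<Sum>m'\<in>Poly_Mapping.keys q.
      mat (Poly_Mapping.lookup p m * Poly_Mapping.lookup q m') ** monom_at_mats d (m + m') T) = F T ** G T"
    if "commuting_tuple d T" for T
    unfolding p(3)[rule_format, OF that, symmetric] q(3)[rule_format, OF that, symmetric]
      poly_at_mats_def matrix_sum_mult
    unfolding matrix_mult_sum_right
    using that by (simp add: mat_mult_mat_mult monom_at_mats_add)
  obtain r where r: "r \<in> polys d" "\<forall>z. poly_at d r z = f z * g z"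
    "\<forall>T :: nat \<Rightarrow> complex^'n^'n. commuting_tuple d T \<longrightarrow> poly_at_mats d r T
      = (\<Sum>m\<in>Poly_Mapping.keys p. \<Sum>m'\<in>Poly_Mapping.keys q.
          mat (Poly_Mapping.lookup p m * Poly_Mapping.lookup q m') ** monom_at_mats d (m + m') T)"
    using pair unfolding poly_eval_pair_def scalar by blast
  have "poly_at_mats d r T = F T ** G T" if "commuting_tuple d T" for T
    using r(3) that unfolding matrix[OF that, symmetric] by blast
  with r(1,2) show ?thesis
    unfolding poly_eval_pair_def by blast
qed

lemma poly_eval_pair_power:
  assumes "poly_eval_pair d f F"
  shows "poly_eval_pair d (\<lambda>z. f z ^ k) (\<lambda>T. mpow (F T) k)"
proof (induction k)
  case (Suc k)
  then show ?case
    using poly_eval_pair_mult[OF assms Suc] by simp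
qed (simp add: poly_eval_pair_const)

lemma poly_eval_pair_coordinate:
  assumes "i < d"
  shows "poly_eval_pair d (\<lambda>z. z i) (\<lambda>T :: nat \<Rightarrow> complex^'n^'n. T i)"
proof -
  have "foldr (\<lambda>j M. mpow (T j) (Poly_Mapping.lookup (Poly_Mapping.single i 1) j) ** M) xs (mat 1)
      = (if i \<in> set xs then T i else mat 1)" if "distinct xs" for xs and T :: "nat \<Rightarrow> complex^'n^'n"
    using that by (induction xs) (auto simp: lookup_single when_def)
  from this[of "[0..<d]"] have "monom_at_mats d (Poly_Mapping.single i 1) T = T i" for T :: "nat \<Rightarrow> complex^'n^'n"
    using assms by (simp add: monom_at_mats_def)
  moreover have "(\<Prod>j<d. z j ^ Poly_Mapping.lookup (Poly_Mapping.single i 1) j) = z i" for z :: "nat \<Rightarrow> complex"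
  proof -
    have "(\<Prod>j<d. z j ^ Poly_Mapping.lookup (Poly_Mapping.single i 1) j) = (\<Prod>j<d. if j = i then z j else 1)"
      by (intro prod.cong) (auto simp: lookup_single when_def)
    then show ?thesis using assms by simp
  qed
  moreover have "poly_eval_pair d (\<lambda>z. 1 * (\<Prod>j<d. z j ^ Poly_Mapping.lookup (Poly_Mapping.single i 1) j))
      (\<lambda>T :: nat \<Rightarrow> complex^'n^'n. mat 1 ** monom_at_mats d (Poly_Mapping.single i 1) T)"
    using assms by (intro poly_eval_pair_monom) simp
  ultimately show ?thesis
    by simp
qed

lemma poly_eval_pair_compose:
  assumes "\<And>j. j < d \<Longrightarrow> poly_eval_pair e (g j) (G j)"
  shows "poly_eval_pair e (\<lambda>z. poly_at d p (\<lambda>j. g j z)) (\<lambda>S. poly_at_mats d p (\<lambda>j. G j S))"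
proof -
  have foldr: "poly_eval_pair e
      (\<lambda>z. foldr (\<lambda>i x. g i z ^ Poly_Mapping.lookup m i * x) xs 1)
      (\<lambda>S. foldr (\<lambda>i M. mpow (G i S) (Poly_Mapping.lookup m i) ** M) xs (mat 1))"
    if "set xs \<subseteq> {..<d}" for xs and m :: "nat \<Rightarrow>\<^sub>0 nat"
    using that
  proof (induction xs)
    case (Cons x xs)
    then show ?case
      using poly_eval_pair_mult[OF poly_eval_pair_power[OF assms[of x]]] by simp
  qed (simp add: poly_eval_pair_const)
  have prod: "foldr (\<lambda>i x. f i * x) [0..<k] 1 = (\<Prod>i<k. f i)" for f :: "nat \<Rightarrow> complex" and k
  proof -
    have "foldr (\<lambda>i x. f i * x) [0..<k] c = (\<Prod>i<k. f i) * c" for c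
      by (induction k arbitrary: c) (simp_all add: mult_ac)
    then show ?thesis by simp
  qed
  have "poly_eval_pair e
      (\<lambda>z. \<Prod>i<d. g i z ^ Poly_Mapping.lookup m i) (\<lambda>S. monom_at_mats d m (\<lambda>j. G j S))" for m
    using foldr[of "[0..<d]" m] by (simp add: prod monom_at_mats_def lessThan_atLeast0)
  then show ?thesis
    unfolding poly_at_def poly_at_mats_def
    by (intro poly_eval_pair_sum poly_eval_pair_mult poly_eval_pair_const)
qed


section \<open>Transfer of von Neumann type bounds\<close>

definition satisfies_vN :: "nat \<Rightarrow> (nat \<Rightarrow> complex^'n^'n) \<Rightarrow> real \<Rightarrow> bool" where
  "satisfies_vN d T C \<longleftrightarrow> (\<forall>p\<in>polys d. opnorm (poly_at_mats d p T) \<le> C * ball_sup d p)"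

lemma vN_bound_iff:
  "vN_bound d TYPE('n::finite) C \<longleftrightarrow>
    (\<forall>T :: nat \<Rightarrow> complex^'n^'n. commuting_tuple d T \<and> row_contractive d T \<longrightarrow> satisfies_vN d T C)"
  by (simp add: vN_bound_def satisfies_vN_def)

lemma cmod_le_one_of_unit_ball:
  assumes "z \<in> unit_ball d" "i < d"
  shows "cmod (z i) \<le> 1"
proof -
  have "(cmod (z i))\<^sup>2 \<le> (\<Sum>i<d. (cmod (z i))\<^sup>2)"
    using assms by (intro member_le_sum) auto
  then have "(cmod (z i))\<^sup>2 \<le> 1\<^sup>2"
    using assms by (simp add: unit_ball_def)
  then show ?thesis
    by (rule power2_le_imp_le) simp
qed

lemma bdd_above_ball: "bdd_above ((\<lambda>z. cmod (poly_at d p z)) ` unit_ball d)"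
proof (rule bdd_aboveI2)
  fix z assume z: "z \<in> unit_ball d"
  have "cmod (\<Prod>i<d. z i ^ Poly_Mapping.lookup m i) \<le> 1" for m
    unfolding prod_norm[symmetric]
    by (intro prod_le_1) (auto simp: norm_power intro!: power_le_one cmod_le_one_of_unit_ball[OF z])
  then show "cmod (poly_at d p z) \<le> (\<Sum>m\<in>Poly_Mapping.keys p. cmod (Poly_Mapping.lookup p m))"
    unfolding poly_at_def
    by (intro sum_norm_le) (auto simp: norm_mult intro!: mult_left_le)
qed

lemma poly_at_le_ball_sup: "z \<in> unit_ball d \<Longrightarrow> cmod (poly_at d p z) \<le> ball_sup d p"
  unfolding ball_sup_def by (rule cSUP_upper[OF _ bdd_above_ball])

lemma zero_in_unit_ball: "(\<lambda>i. 0) \<in> unit_ball d"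
  by (simp add: unit_ball_def)

lemma ball_sup_le: "(\<And>z. z \<in> unit_ball d \<Longrightarrow> cmod (poly_at d p z) \<le> B) \<Longrightarrow> ball_sup d p \<le> B"
  unfolding ball_sup_def using zero_in_unit_ball by (intro cSUP_least) auto

lemma ball_sup_nonneg: "0 \<le> ball_sup d p"
  using poly_at_le_ball_sup[OF zero_in_unit_ball, of d p] norm_ge_zero order_trans by blast

lemma poly_at_mats_cong:
  assumes "\<And>j. j < d \<Longrightarrow> T j = S j"
  shows "poly_at_mats d p T = poly_at_mats d p S"
proof -
  have "foldr (\<lambda>i M. mpow (T i) (Poly_Mapping.lookup m i) ** M) [0..<d] (mat 1)
      = foldr (\<lambda>i M. mpow (S i) (Poly_Mapping.lookup m i) ** M) [0..<d] (mat 1)" for m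
    by (rule foldr_cong) (use assms in auto)
  then show ?thesis by (simp add: poly_at_mats_def monom_at_mats_def)
qed

lemma satisfies_vN_cong:
  "(\<And>j. j < d \<Longrightarrow> T j = S j) \<Longrightarrow> satisfies_vN d T C \<longleftrightarrow> satisfies_vN d S C"
  using poly_at_mats_cong[of d T S] by (simp add: satisfies_vN_def)

text \<open>
  Composing a polynomial in \<open>d\<close> variables with a polynomial map of balls yields a
  polynomial in \<open>e\<close> variables with no larger supremum, and evaluating the composition
  at \<open>S\<close> evaluates the original polynomial at the image of \<open>S\<close>.
\<close>

lemma satisfies_vN_polynomial_image:
  assumes S: "satisfies_vN e S C" "commuting_tuple e S" and "0 \<le> C"
    and g: "\<And>j. j < d \<Longrightarrow> poly_eval_pair e (g j) (G j)"
    and ball: "\<And>z. z \<in> unit_ball e \<Longrightarrow> (\<lambda>j. g j z) \<in> unit_ball d"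
  shows "satisfies_vN d (\<lambda>j. G j S) C"
  unfolding satisfies_vN_def
proof
  fix p assume "p \<in> polys d"
  have "poly_eval_pair e (\<lambda>z. poly_at d p (\<lambda>j. g j z)) (\<lambda>S. poly_at_mats d p (\<lambda>j. G j S))"
    using g by (rule poly_eval_pair_compose)
  then obtain q where q: "q \<in> polys e" "\<forall>z. poly_at e q z = poly_at d p (\<lambda>j. g j z)"
    "poly_at_mats e q S = poly_at_mats d p (\<lambda>j. G j S)"
    using S(2) unfolding poly_eval_pair_def by blast
  have "opnorm (poly_at_mats d p (\<lambda>j. G j S)) \<le> C * ball_sup e q"
    using S(1) q(1) unfolding satisfies_vN_def q(3)[symmetric] by blast
  also have "ball_sup e q \<le> ball_sup d p"
    by (rule ball_sup_le) (use q(2) poly_at_le_ball_sup[OF ball] in simp)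
  finally show "opnorm (poly_at_mats d p (\<lambda>j. G j S)) \<le> C * ball_sup d p"
    using \<open>0 \<le> C\<close> by (simp add: mult_left_mono)
qed

lemma tendsto_mpow: "A \<longlonglongrightarrow> B \<Longrightarrow> (\<lambda>n. mpow (A n) k) \<longlonglongrightarrow> mpow B k"
  by (induction k) (auto intro: tendsto_matrix_mult)

lemma tendsto_poly_at_mats:
  assumes "\<And>j. j < d \<Longrightarrow> (\<lambda>n. Tn n j) \<longlonglongrightarrow> T j"
  shows "(\<lambda>n. poly_at_mats d p (Tn n)) \<longlonglongrightarrow> poly_at_mats d p T"
proof -
  have "(\<lambda>n. foldr (\<lambda>i M. mpow (Tn n i) (Poly_Mapping.lookup m i) ** M) xs (mat 1))
      \<longlonglongrightarrow> foldr (\<lambda>i M. mpow (T i) (Poly_Mapping.lookup m i) ** M) xs (mat 1)"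
    if "set xs \<subseteq> {..<d}" for xs m
    using that by (induction xs) (auto intro!: tendsto_matrix_mult tendsto_mpow assms)
  from this[of "[0..<d]"] show ?thesis
    unfolding poly_at_mats_def monom_at_mats_def
    by (intro tendsto_sum tendsto_matrix_mult tendsto_const) (auto simp: lessThan_atLeast0)
qed

text \<open>
  For a fixed polynomial the right-hand side does not involve the tuple, and the left-hand side is
  continuous in it.
\<close>

lemma satisfies_vN_limit:
  assumes "\<And>n. satisfies_vN d (Tn n) C" "\<And>j. j < d \<Longrightarrow> (\<lambda>n. Tn n j) \<longlonglongrightarrow> T j"
  shows "satisfies_vN d T C"
  unfolding satisfies_vN_def
proof
  fix p assume "p \<in> polys d"
  show "opnorm (poly_at_mats d p T) \<le> C * ball_sup d p"
    by (rule opnorm_le_limit[of "\<lambda>n. poly_at_mats d p (Tn n)"])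
      (use assms \<open>p \<in> polys d\<close> in \<open>auto simp: satisfies_vN_def intro!: tendsto_vec_nth tendsto_poly_at_mats\<close>)
qed

text \<open>
  Row contractions may thus be assumed strict.
\<close>

lemma satisfies_vN_scale:
  assumes "\<And>r. 0 \<le> r \<Longrightarrow> r < 1 \<Longrightarrow> satisfies_vN d (\<lambda>j. r *\<^sub>R T j) C"
  shows "satisfies_vN d T C"
proof (rule satisfies_vN_limit)
  show "satisfies_vN d (\<lambda>j. (1 - inverse (real (Suc n))) *\<^sub>R T j) C" for n
    by (rule assms) (auto simp: field_simps)
  have "(\<lambda>n. 1 - inverse (real (Suc n))) \<longlonglongrightarrow> 1 - 0"
    by (intro tendsto_diff tendsto_const LIMSEQ_inverse_real_of_nat)
  then show "(\<lambda>n. (1 - inverse (real (Suc n))) *\<^sub>R T j) \<longlonglongrightarrow> T j" for j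
    using tendsto_scaleR[OF _ tendsto_const, of _ 1 sequentially "T j"] by simp
qed

lemma poly_at_mats_unitary:
  fixes U :: "complex^'n^'n"
  assumes "ctranspose U ** U = mat 1" "U ** ctranspose U = mat 1"
  shows "poly_at_mats d p (\<lambda>j. ctranspose U ** T j ** U) = ctranspose U ** poly_at_mats d p T ** U"
proof -
  let ?c = "\<lambda>A. ctranspose U ** A ** U"
  have mult: "?c A ** ?c B = ?c (A ** B)" for A B
  proof -
    have "?c A ** ?c B = ctranspose U ** A ** (U ** ctranspose U) ** B ** U"
      by (simp only: matrix_mul_assoc)
    then show ?thesis by (simp only: assms matrix_mul_rid matrix_mul_assoc)
  qed
  have pow: "mpow (?c A) k = ?c (mpow A k)" for A k
    by (induction k) (simp_all add: assms mult)
  have "foldr (\<lambda>i M. mpow (?c (T i)) (Poly_Mapping.lookup m i) ** M) xs (mat 1)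
      = ?c (foldr (\<lambda>i M. mpow (T i) (Poly_Mapping.lookup m i) ** M) xs (mat 1))" for m xs
    by (induction xs) (simp_all add: assms mult pow)
  then have mono: "monom_at_mats d m (\<lambda>j. ?c (T j)) = ?c (monom_at_mats d m T)" for m
    by (simp add: monom_at_mats_def)
  have scale: "mat a ** ?c A = ?c (mat a ** A)" for a A
    by (metis mat_commute matrix_mul_assoc)
  show ?thesis
    unfolding poly_at_mats_def
    by (simp only: mono scale matrix_sum_mult matrix_mult_sum_right)
qed

lemma norm_isometry_vector:
  fixes U :: "complex^'n^'n"
  assumes "ctranspose U ** U = mat 1"
  shows "norm (U *v x) = norm (x :: complex^'n)"
proof -
  have "hdot (U *v x) (U *v x) = hdot x x"
    using assms by (simp add: hdot_ctranspose'[symmetric] matrix_vector_mul_assoc)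
  then show ?thesis
    unfolding hdot_self by (simp only: of_real_eq_iff power2_eq_iff_nonneg norm_ge_zero)
qed

lemma satisfies_vN_unitary:
  fixes U :: "complex^'n^'n"
  assumes "ctranspose U ** U = mat 1" "U ** ctranspose U = mat 1"
    and "satisfies_vN d (\<lambda>j. ctranspose U ** T j ** U) C"
  shows "satisfies_vN d T C"
  unfolding satisfies_vN_def opnorm_le_iff
proof (intro ballI allI)
  fix p x assume "p \<in> polys d"
  define P where "P = poly_at_mats d p T"
  have U': "norm (ctranspose U *v y) = norm y" for y
    by (rule norm_isometry_vector) (simp add: assms(2))
  have "norm (P *v x) = norm (ctranspose U *v (P *v ((U ** ctranspose U) *v x)))"
    by (simp add: U' assms(2))
  also have "\<dots> = norm ((ctranspose U ** P ** U) *v (ctranspose U *v x))"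
    by (simp only: matrix_mul_assoc matrix_vector_mul_assoc)
  also have "\<dots> \<le> C * ball_sup d p * norm (ctranspose U *v x)"
    using assms(3) \<open>p \<in> polys d\<close>
    unfolding satisfies_vN_def poly_at_mats_unitary[OF assms(1,2)] opnorm_le_iff P_def by blast
  finally show "norm (P *v x) \<le> C * ball_sup d p * norm x"
    by (simp add: U')
qed

section \<open>Von Neumann's inequality for a single contraction\<close>

definition root_of_unity :: "nat \<Rightarrow> nat \<Rightarrow> complex" where
  "root_of_unity L j = exp (2 * of_real pi * \<i> * of_nat j / of_nat L)"

lemma cmod_root_of_unity [simp]: "cmod (root_of_unity L j) = 1"
proof -
  have "root_of_unity L j = exp (\<i> * of_real (2 * pi * real j / real L))"
    by (simp add: root_of_unity_def mult_ac)
  then show ?thesis by (simp only: norm_exp_i_times)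
qed

lemma root_of_unity_orthogonal:
  assumes "a < L" "b < L"
  shows "(\<Sum>j<L. root_of_unity L j ^ a * cnj (root_of_unity L j) ^ b) = (if a = b then of_nat L else 0)"
proof -
  define w where "w = root_of_unity L a / root_of_unity L b"
  have unit: "root_of_unity L j * cnj (root_of_unity L j) = 1" for j
    using complex_norm_square[of "root_of_unity L j"] by simp
  then have inv: "cnj (root_of_unity L j) = inverse (root_of_unity L j)" for j
    by (metis inverse_unique)
  have pow: "root_of_unity L j ^ a = root_of_unity L a ^ j" for j a
    unfolding root_of_unity_def exp_of_nat_mult[symmetric] by (simp add: mult_ac)
  have term_eq: "root_of_unity L j ^ a * cnj (root_of_unity L j) ^ b = w ^ j" for j
    unfolding inv power_inverse w_def divide_inverse power_mult_distrib pow[of j a] pow[of j b] by (rule refl)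
  have nz: "root_of_unity L j \<noteq> 0" for j
    by (simp add: root_of_unity_def)
  show ?thesis
  proof (cases "a = b")
    case True
    then have "w = 1" using nz by (simp add: w_def)
    then show ?thesis using True unfolding term_eq by simp
  next
    case False
    have one: "root_of_unity L a ^ L = 1" for a
      using assms complex_root_unity[of L a] by (simp add: root_of_unity_def)
    have "w ^ L = 1"
      by (simp add: w_def power_divide one)
    moreover have "root_of_unity L a \<noteq> root_of_unity L b"
      using complex_root_unity_eq[of L a b] assms False
      by (simp add: root_of_unity_def cong_def)
    then have "w \<noteq> 1"
      using nz by (simp add: w_def)
    ultimately have "(\<Sum>j<L. w ^ j) = 0"
      by (simp add: sum_gp_strict)
    then show ?thesis using False by (simp add: term_eq)
  qed
qed

text \<open>
  The sesquilinear form of \<open>I - A A\<^sup>*\<close>, which is positive semidefinite for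
  contractions \<open>A\<close>.
\<close>

definition defect :: "complex^'n^'n \<Rightarrow> complex^'n \<Rightarrow> complex^'n \<Rightarrow> complex" where
  "defect A u v = hdot u v - hdot (ctranspose A *v u) (ctranspose A *v v)"

lemma defect_sum: "defect A (\<Sum>j\<in>J. f j) z = (\<Sum>j\<in>J. defect A (f j) z)"
    "defect A z (\<Sum>j\<in>J. f j) = (\<Sum>j\<in>J. defect A z (f j))"
  by (simp_all add: defect_def hdot_sum matrix_vector_mult_sum sum_subtractf)

lemma defect_scale: "defect A (c *s x) y = cnj c * defect A x y" "defect A x (c *s y) = c * defect A x y"
  by (simp_all add: defect_def hdot_scale vector_scalar_commute algebra_simps)

lemma defect_self: "defect A u u = of_real ((norm u)\<^sup>2 - (norm (ctranspose A *v u))\<^sup>2)"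
  by (simp add: defect_def hdot_self)

text \<open>
  The Cauchy--Schwarz inequality for a positive semidefinite form, weakened to an arithmetic mean. It
  follows from positivity at \<open>u - \<theta> v\<close> for the unimodular
  \<open>\<theta>\<close> that makes the mixed term real and nonnegative, and it avoids square roots
  in the sums over roots of unity below.
\<close>

lemma defect_le_mean:
  assumes contr: "\<And>x. norm (ctranspose A *v x) \<le> norm x"
  shows "cmod (defect A u v) \<le> (Re (defect A u u) + Re (defect A v v)) / 2"
proof -
  have nonneg: "0 \<le> Re (defect A x x)" for x
    using contr[of x] by (simp add: defect_self)
  show ?thesis
  proof (cases "defect A u v = 0")
    case True
    then show ?thesis using nonneg[of u] nonneg[of v] by simp
  next
    case False
    define \<theta> where "\<theta> = cnj (defect A u v) / cmod (defect A u v)"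
    have \<theta>: "cnj \<theta> * \<theta> = 1" "\<theta> * defect A u v = cmod (defect A u v)"
      using False complex_norm_square[of "defect A u v"]
      by (simp_all add: \<theta>_def field_simps power2_eq_square)
    have sym: "defect A v u = cnj (defect A u v)"
      by (simp add: defect_def cnj_hdot)
    have "defect A (u - \<theta> *s v) (u - \<theta> *s v)
        = defect A u u - \<theta> * defect A u v - cnj (\<theta> * defect A u v) + cnj \<theta> * \<theta> * defect A v v"
      unfolding complex_cnj_mult sym[symmetric]
      by (simp add: defect_def hdot_diff hdot_scale matrix_vector_mult_diff_distrib vector_scalar_commute
          algebra_simps)
    then have "defect A (u - \<theta> *s v) (u - \<theta> *s v)
        = defect A u u - 2 * cmod (defect A u v) + defect A v v"
      unfolding \<theta> by simp
    then show ?thesis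
      using nonneg[of "u - \<theta> *s v"] by simp
  qed
qed

lemma defect_telescope:
  "(\<Sum>l<n. defect A (mpow (ctranspose A) l *v u) (mpow (ctranspose A) l *v v))
    = hdot u v - hdot (mpow (ctranspose A) n *v u) (mpow (ctranspose A) n *v v)"
  by (induction n) (simp_all add: defect_def matrix_vector_mul_assoc)

text \<open>
  A truncation of the Neumann series of \<open>(1 - z A\<^sup>*)\<^sup>-\<^sup>1 x\<close>; inserting
  two of these into the defect form yields a truncated operator-valued Poisson kernel.
\<close>

definition orbit_sum :: "complex^'n^'n \<Rightarrow> nat \<Rightarrow> complex \<Rightarrow> complex^'n \<Rightarrow> complex^'n" where
  "orbit_sum A N z x = (\<Sum>k<N. z ^ k *s (mpow (ctranspose A) k *v x))"

text \<open>
  Expanding the defect gives terms indexed by pairs \<open>k, l < N\<close>, and averaging against the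
  \<open>m\<close>-th power keeps those with \<open>k \<equiv> m + l\<close> modulo
  \<open>L\<close>. Since \<open>L \<ge> N + m\<close>, these are the pairs with \<open>k = m +
  l\<close>, whose sum telescopes.
\<close>

lemma root_average_defect:
  assumes "m \<le> N" "N + m \<le> L"
  shows "(\<Sum>j<L. root_of_unity L j ^ m *
      defect A (orbit_sum A N (root_of_unity L j) y) (orbit_sum A N (root_of_unity L j) x))
    = of_nat L * (hdot (mpow (ctranspose A) m *v y) x
        - hdot (mpow (ctranspose A) N *v y) (mpow (ctranspose A) (N - m) *v x))"
proof -
  let ?H = "\<lambda>k. mpow (ctranspose A) k"
  define h where "h k l = defect A (?H k *v y) (?H l *v x)" for k l
  have expand: "defect A (orbit_sum A N z y) (orbit_sum A N z x)
      = (\<Sum>l<N. \<Sum>k<N. z ^ l * (cnj z ^ k * h k l))" for z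
  proof -
    have "defect A (orbit_sum A N z y) (orbit_sum A N z x)
        = (\<Sum>l<N. z ^ l * defect A (orbit_sum A N z y) (?H l *v x))"
      unfolding orbit_sum_def[of A N z x] defect_sum(2) defect_scale(2) ..
    also have "\<dots> = (\<Sum>l<N. \<Sum>k<N. z ^ l * (cnj z ^ k * h k l))"
      unfolding orbit_sum_def defect_sum(1) defect_scale(1) h_def sum_distrib_left
        complex_cnj_power ..
    finally show ?thesis .
  qed
  have "(\<Sum>j<L. root_of_unity L j ^ m *
      defect A (orbit_sum A N (root_of_unity L j) y) (orbit_sum A N (root_of_unity L j) x))
    = (\<Sum>j<L. \<Sum>l<N. \<Sum>k<N. h k l * (root_of_unity L j ^ (m + l) * cnj (root_of_unity L j) ^ k))"
    unfolding expand sum_distrib_left power_add by (simp only: mult_ac)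
  also have "\<dots> = (\<Sum>l<N. \<Sum>j<L. \<Sum>k<N. h k l * (root_of_unity L j ^ (m + l) * cnj (root_of_unity L j) ^ k))"
    by (rule sum.swap)
  also have "\<dots> = (\<Sum>l<N. \<Sum>k<N. h k l * (\<Sum>j<L. root_of_unity L j ^ (m + l) * cnj (root_of_unity L j) ^ k))"
    unfolding sum_distrib_left by (subst sum.swap) (rule refl)
  also have "\<dots> = (\<Sum>l<N. \<Sum>k<N. if m + l = k then h k l * of_nat L else 0)"
    using assms by (intro sum.cong refl) (simp add: root_of_unity_orthogonal)
  also have "\<dots> = (\<Sum>l<N. if m + l < N then h (m + l) l * of_nat L else 0)"
    by (intro sum.cong refl) simp
  also have "\<dots> = (\<Sum>l<N - m. h (m + l) l * of_nat L)"
    by (intro sum.mono_neutral_cong_right) auto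
  also have "\<dots> = of_nat L * (\<Sum>l<N - m. defect A (?H l *v (?H m *v y)) (?H l *v x))"
    by (simp add: h_def sum_distrib_left matrix_vector_mul_assoc mpow_add[symmetric] add.commute mult.commute)
  also have "\<dots> = of_nat L * (hdot (?H m *v y) x - hdot (?H (N - m) *v (?H m *v y)) (?H (N - m) *v x))"
    by (simp only: defect_telescope)
  also have "?H (N - m) *v (?H m *v y) = ?H N *v y"
    using assms by (simp add: matrix_vector_mul_assoc mpow_add[symmetric])
  finally show ?thesis .
qed

text \<open>
  By linearity of \<open>root_average_defect\<close> in the powers, averaging the values of a
  polynomial \<open>f\<close> on roots of unity against the truncated Poisson kernel produces
  \<open>f(A)\<close> up to terms of size \<open>\<rho>\<^sup>N\<close>. The kernel is positive with
  total mass at most \<open>1\<close>, so the average is bounded by the supremum of \<open>f\<close>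
  on the circle.
\<close>

lemma von_Neumann_one_variable:
  fixes A :: "complex^'n^'n" and c :: "'k \<Rightarrow> complex" and e :: "'k \<Rightarrow> nat"
  assumes "finite K" and \<rho>: "\<rho> < 1" "\<And>x. norm (ctranspose A *v x) \<le> \<rho> * norm x"
    and bound: "\<And>z. cmod z = 1 \<Longrightarrow> cmod (\<Sum>m\<in>K. c m * z ^ e m) \<le> B"
  shows "opnorm (\<Sum>m\<in>K. mat (c m) ** mpow A (e m)) \<le> B"
proof (rule opnorm_le_hdot)
  fix x y :: "complex^'n" assume xy: "norm x = 1" "norm y = 1"
  let ?H = "\<lambda>k. mpow (ctranspose A) k"
  define f where "f z = (\<Sum>m\<in>K. c m * z ^ e m)" for z
  have "0 \<le> \<rho>"
    using \<rho>(2)[of x] norm_ge_zero[of "ctranspose A *v x"] unfolding xy(1) by linarith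
  have contr: "norm (ctranspose A *v v) \<le> norm v" for v
  proof -
    have "\<rho> * norm v \<le> 1 * norm v"
      using \<open>\<rho> < 1\<close> by (intro mult_right_mono) auto
    with \<rho>(2)[of v] show ?thesis by linarith
  qed
  have pow: "norm (?H k *v v) \<le> \<rho> ^ k * norm v" for k v
  proof (induction k)
    case (Suc k)
    have "norm (?H (Suc k) *v v) \<le> \<rho> * norm (?H k *v v)"
      using \<rho>(2)[of "?H k *v v"] by (simp add: matrix_vector_mul_assoc)
    also have "\<dots> \<le> \<rho> * (\<rho> ^ k * norm v)"
      using Suc \<open>0 \<le> \<rho>\<close> by (intro mult_left_mono)
    finally show ?case by (simp add: mult_ac)
  qed simp
  have "0 \<le> B"
    by (rule order_trans[OF norm_ge_zero bound[of 1]]) simp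
  define M where "M = Max (insert 0 (e ` K))"
  have M: "e m \<le> M" if "m \<in> K" for m
    using that \<open>finite K\<close> by (simp add: M_def)
  define S where "S = hdot y ((\<Sum>m\<in>K. mat (c m) ** mpow A (e m)) *v x)"
  have S: "S = (\<Sum>m\<in>K. c m * hdot (?H (e m) *v y) x)"
    by (simp add: S_def sum_matrix_vector_mult hdot_sum matrix_vector_mul_assoc[symmetric]
        mat_vector_mult hdot_scale hdot_ctranspose[symmetric] ctranspose_mpow[symmetric])
  have approx: "cmod S \<le> B + (\<Sum>m\<in>K. cmod (c m)) * \<rho> ^ N" if "M < N" for N
  proof -
    \<comment> \<open>large enough for \<open>root_average_defect\<close> to apply to every exponent\<close>
    define L where "L = N + M"
    have "0 < L" using that by (simp add: L_def)
    define R where "R = (\<Sum>m\<in>K. c m * hdot (?H N *v y) (?H (N - e m) *v x))"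
    let ?u = "\<lambda>j. orbit_sum A N (root_of_unity L j)"
    have mean: "(\<Sum>j<L. Re (defect A (?u j v) (?u j v))) \<le> L" if "norm v = 1" for v
    proof -
      have "(\<Sum>j<L. Re (defect A (?u j v) (?u j v)))
          = Re (\<Sum>j<L. root_of_unity L j ^ 0 * defect A (?u j v) (?u j v))"
        by simp
      also have "\<dots> = L * (1 - (norm (?H N *v v))\<^sup>2)"
        using that by (subst root_average_defect) (simp_all add: L_def hdot_self)
      also have "\<dots> \<le> L"
        by (simp add: mult_left_le)
      finally show ?thesis .
    qed
    have "of_nat L * (S - R) = (\<Sum>m\<in>K. c m * (of_nat L *
        (hdot (?H (e m) *v y) x - hdot (?H N *v y) (?H (N - e m) *v x))))"
      by (simp add: S R_def sum_distrib_left sum_subtractf algebra_simps)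
    also have "\<dots> = (\<Sum>m\<in>K. c m * (\<Sum>j<L. root_of_unity L j ^ e m * defect A (?u j y) (?u j x)))"
    proof (intro sum.cong refl)
      fix m assume "m \<in> K"
      then have "e m \<le> N" "N + e m \<le> L"
        using M[of m] that by (auto simp: L_def)
      then show "c m * (of_nat L * (hdot (?H (e m) *v y) x - hdot (?H N *v y) (?H (N - e m) *v x)))
          = c m * (\<Sum>j<L. root_of_unity L j ^ e m * defect A (?u j y) (?u j x))"
        by (simp only: root_average_defect)
    qed
    also have "\<dots> = (\<Sum>j<L. f (root_of_unity L j) * defect A (?u j y) (?u j x))"
      unfolding sum_distrib_left f_def sum_distrib_right by (subst sum.swap) (simp add: mult_ac)
    finally have "L * cmod (S - R) = cmod (\<Sum>j<L. f (root_of_unity L j) * defect A (?u j y) (?u j x))"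
      by (metis norm_mult norm_of_nat)
    also have "\<dots> \<le> (\<Sum>j<L. B * ((Re (defect A (?u j y) (?u j y)) + Re (defect A (?u j x) (?u j x))) / 2))"
      unfolding f_def
      by (intro sum_norm_le) (auto simp only: norm_mult intro!: mult_mono bound defect_le_mean[OF contr]
          cmod_root_of_unity \<open>0 \<le> B\<close> norm_ge_zero)
    also have "\<dots> = B * ((\<Sum>j<L. Re (defect A (?u j y) (?u j y))) + (\<Sum>j<L. Re (defect A (?u j x) (?u j x)))) / 2"
      by (simp add: sum_distrib_left sum.distrib add_divide_distrib sum_divide_distrib distrib_left)
    also have "\<dots> \<le> B * (L + L) / 2"
      using mean[OF xy(1)] mean[OF xy(2)] \<open>0 \<le> B\<close>
      by (intro divide_right_mono mult_left_mono add_mono) auto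
    finally have "cmod (S - R) \<le> B"
      using \<open>0 < L\<close> by (simp add: field_simps)
    moreover have "cmod R \<le> (\<Sum>m\<in>K. cmod (c m)) * \<rho> ^ N"
      unfolding R_def sum_distrib_right
    proof (intro sum_norm_le)
      fix m
      have "norm (?H N *v y) \<le> \<rho> ^ N" "norm (?H (N - e m) *v x) \<le> 1"
        using pow[of N y] pow[of "N - e m" x] xy \<open>0 \<le> \<rho>\<close> \<open>\<rho> < 1\<close> power_le_one[of \<rho> "N - e m"] by auto
      then have "norm (?H N *v y) * norm (?H (N - e m) *v x) \<le> \<rho> ^ N * 1"
        by (intro mult_mono) (use \<open>0 \<le> \<rho>\<close> in auto)
      then have "cmod (hdot (?H N *v y) (?H (N - e m) *v x)) \<le> \<rho> ^ N"
        using hdot_Cauchy_Schwarz[of "?H N *v y" "?H (N - e m) *v x"] by linarith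
      then show "cmod (c m * hdot (?H N *v y) (?H (N - e m) *v x)) \<le> cmod (c m) * \<rho> ^ N"
        by (simp add: norm_mult mult_left_mono)
    qed
    ultimately show ?thesis
      using norm_triangle_sub[of S R] by linarith
  qed
  have "(\<lambda>N. B + (\<Sum>m\<in>K. cmod (c m)) * \<rho> ^ N) \<longlonglongrightarrow> B + (\<Sum>m\<in>K. cmod (c m)) * 0"
    using \<open>0 \<le> \<rho>\<close> \<open>\<rho> < 1\<close> by (intro tendsto_intros LIMSEQ_realpow_zero) auto
  moreover have "\<forall>\<^sub>F N in sequentially. cmod S \<le> B + (\<Sum>m\<in>K. cmod (c m)) * \<rho> ^ N"
    using eventually_gt_at_top[of M] by eventually_elim (rule approx)
  ultimately have "cmod S \<le> B + (\<Sum>m\<in>K. cmod (c m)) * 0"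
    by (rule tendsto_lowerbound) simp
  then show "cmod (hdot y ((\<Sum>m\<in>K. mat (c m) ** mpow A (e m)) *v x)) \<le> B"
    by (simp add: S_def)
qed

section \<open>Pairs whose second matrix is a single row\<close>

lemma hdot_axis: "hdot (axis i 1) x = x $ i"
proof -
  have "hdot (axis i 1) x = (\<Sum>j\<in>UNIV. if j = i then x $ j else 0)"
    unfolding hdot_def by (intro sum.cong refl) (simp add: axis_def)
  then show ?thesis by simp
qed

lemma ctranspose_axis_nth: "(ctranspose A *v axis i 1) $ k = cnj (A $ i $ k)"
  by (simp add: matrix_vector_mult_def axis_def if_distrib cong: if_cong)

lemma monom_at_mats_2:
  "monom_at_mats 2 m T = mpow (T 0) (Poly_Mapping.lookup m 0) ** mpow (T 1) (Poly_Mapping.lookup m 1)"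
  by (simp add: monom_at_mats_def upt_rec numeral_2_eq_2)

lemma poly_at_2:
  "poly_at 2 p z = (\<Sum>m\<in>Poly_Mapping.keys p. Poly_Mapping.lookup p m *
     (z 0 ^ Poly_Mapping.lookup m 0 * z 1 ^ Poly_Mapping.lookup m 1))"
  by (simp add: poly_at_def numeral_2_eq_2)

lemma unit_ball_2: "z \<in> unit_ball 2 \<longleftrightarrow> (cmod (z 0))\<^sup>2 + (cmod (z 1))\<^sup>2 < 1"
  by (simp add: unit_ball_def numeral_2_eq_2)

text \<open>
  The product only sees the column of \<open>A\<close> that meets the nonzero row of \<open>B\<close>;
  that column is a multiple of a basis vector, which is an eigenvector of \<open>A\<close>.
\<close>

lemma matrix_mult_single_row:
  fixes A B :: "complex^'n^'n"
  assumes "\<And>j. j \<noteq> i \<Longrightarrow> A $ j $ i = 0" "\<And>j k. j \<noteq> i \<Longrightarrow> B $ j $ k = 0"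
  shows "A ** B = mat (A $ i $ i) ** B"
proof -
  have "(A ** B) $ j $ k = (mat (A $ i $ i) ** B) $ j $ k" for j k
  proof -
    have "(A ** B) $ j $ k = (\<Sum>l\<in>UNIV. if l = i then A $ j $ l * B $ l $ k else 0)"
      unfolding matrix_matrix_mult_def vec_lambda_beta by (intro sum.cong refl) (simp add: assms(2))
    then show ?thesis
      using assms by (cases "j = i") (auto simp: mat_matrix_mult_nth)
  qed
  then show ?thesis by (simp add: vec_eq_iff)
qed

text \<open>
  The Schwarz lemma in quantitative form: on the circle the factor \<open>w\<close> contributes
  exactly \<open>t\<close>, and the maximum principle carries the resulting bound for the quotient
  inside.
\<close>

lemma max_modulus_quotient:
  assumes "finite K" "0 < t" "cmod b \<le> t"
    and bound: "\<And>w. cmod w = t \<Longrightarrow> cmod (\<Sum>m\<in>K. c m * w ^ Suc (e m)) \<le> B"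
  shows "cmod (\<Sum>m\<in>K. c m * b ^ e m) * t \<le> (B::real)"
proof -
  define Q where "Q w = (\<Sum>m\<in>K. c m * w ^ e m)" for w
  have "cmod (Q b) \<le> B / t"
  proof (rule maximum_modulus_frontier[where S = "cball 0 t" and f = Q and \<xi> = b])
    show "Q holomorphic_on interior (cball 0 t)"
      unfolding Q_def by (intro holomorphic_intros)
    show "continuous_on (closure (cball 0 t)) Q"
      unfolding Q_def by (intro continuous_intros)
    show "cmod (Q w) \<le> B / t" if "w \<in> frontier (cball 0 t)" for w
    proof -
      have w: "cmod w = t" using that \<open>0 < t\<close> by (simp add: dist_norm)
      have "(\<Sum>m\<in>K. c m * w ^ Suc (e m)) = w * Q w"
        by (simp add: Q_def sum_distrib_left mult_ac)
      then have "t * cmod (Q w) \<le> B"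
        using bound[OF w] w by (simp add: norm_mult)
      then show ?thesis using \<open>0 < t\<close> by (simp add: field_simps)
    qed
  qed (use assms in auto)
  then show ?thesis
    using \<open>0 < t\<close> by (simp add: Q_def field_simps)
qed

text \<open>
  The terms of \<open>p\<close> free of the second variable form a polynomial in the contraction
  \<open>R 0\<close> and contribute at most the supremum \<open>M\<close> of \<open>p\<close>. In
  every other term the matrix \<open>R 1\<close> absorbs the remaining powers as eigenvalues, so
  these terms add up to a number times \<open>R 1\<close>. After shrinking the pair by a factor
  \<open>r < 1\<close>, let \<open>a\<close> be the eigenvalue of the first matrix and
  \<open>t\<^sup>2 = r\<^sup>2 - \<bar>a\<bar>\<^sup>2\<close>. The number is at most \<open>2 M /
  t\<close> by the maximum principle on the disc of radius \<open>t\<close>, and the second matrix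
  has norm at most \<open>t\<close> because the \<open>i\<close>-th columns of the two adjoints
  together have length at most \<open>r\<close>.
\<close>

lemma satisfies_vN_rank_one_row:
  fixes R :: "nat \<Rightarrow> complex^'n^'n"
  assumes contr: "row_contractive 2 R"
    and eig: "\<And>j. j \<noteq> i \<Longrightarrow> R 0 $ j $ i = 0"
    and row: "\<And>j k. j \<noteq> i \<Longrightarrow> R 1 $ j $ k = 0"
  shows "satisfies_vN 2 R 3"
proof (rule satisfies_vN_scale)
  fix r :: real assume r: "0 \<le> r" "r < 1"
  define T where "T j = r *\<^sub>R R j" for j
  have Tadj: "ctranspose (T j) *v x = r *\<^sub>R (ctranspose (R j) *v x)" for j x
    by (simp add: T_def vec_eq_iff matrix_vector_mult_def scaleR_sum_right)
  have T: "(norm (ctranspose (T 0) *v x))\<^sup>2 + (norm (ctranspose (T 1) *v x))\<^sup>2 \<le> r\<^sup>2 * (norm x)\<^sup>2" for x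
  proof -
    have "(norm (ctranspose (R 0) *v x))\<^sup>2 + (norm (ctranspose (R 1) *v x))\<^sup>2 \<le> (norm x)\<^sup>2"
      using contr by (simp add: row_contractive_iff numeral_2_eq_2)
    then have "r\<^sup>2 * ((norm (ctranspose (R 0) *v x))\<^sup>2 + (norm (ctranspose (R 1) *v x))\<^sup>2) \<le> r\<^sup>2 * (norm x)\<^sup>2"
      by (intro mult_left_mono) auto
    then show ?thesis by (simp add: Tadj power_mult_distrib distrib_left)
  qed
  define a b where "a = T 0 $ i $ i" and "b = T 1 $ i $ i"
  have T0T1: "T 0 ** T 1 = mat a ** T 1" "T 1 ** T 1 = mat b ** T 1"
    unfolding a_def b_def
    by (rule matrix_mult_single_row; use eig row in \<open>simp add: T_def\<close>)+
  have pow0: "mpow (T 0) k ** T 1 = mat (a ^ k) ** T 1" for k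
  proof (induction k)
    case (Suc k)
    have "mpow (T 0) (Suc k) ** T 1 = T 0 ** (mat (a ^ k) ** T 1)"
      using Suc by (simp add: matrix_mul_assoc[symmetric])
    also have "\<dots> = mat (a ^ k) ** (mat a ** T 1)"
      unfolding matrix_mul_assoc mat_commute[of "a ^ k" "T 0", symmetric]
      by (simp only: matrix_mul_assoc[symmetric] T0T1)
    also have "\<dots> = mat (a ^ Suc k) ** T 1"
      by (simp add: vec_eq_iff mat_matrix_mult_nth)
    finally show ?case .
  qed simp
  have pow1: "mpow (T 1) (Suc k) = mat (b ^ k) ** T 1" for k
  proof (induction k)
    case (Suc k)
    have "mpow (T 1) (Suc (Suc k)) = T 1 ** (mat (b ^ k) ** T 1)"
      using Suc by simp
    also have "\<dots> = mat (b ^ k) ** (mat b ** T 1)"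
      unfolding matrix_mul_assoc mat_commute[of "b ^ k" "T 1", symmetric]
      by (simp only: matrix_mul_assoc[symmetric] T0T1)
    also have "\<dots> = mat (b ^ Suc k) ** T 1"
      by (simp add: vec_eq_iff mat_matrix_mult_nth)
    finally show ?case .
  qed simp
  show "satisfies_vN 2 (\<lambda>j. r *\<^sub>R R j) 3"
    unfolding satisfies_vN_def T_def[symmetric]
  proof
    fix p :: cpoly
    define M where "M = ball_sup 2 p"
    define c where "c = Poly_Mapping.lookup p"
    define e f where "e m = Poly_Mapping.lookup m (0::nat)" and "f m = Poly_Mapping.lookup m (1::nat)"
      for m :: "nat \<Rightarrow>\<^sub>0 nat"
    define K0 K1 where "K0 = {m \<in> Poly_Mapping.keys p. f m = 0}"
      and "K1 = {m \<in> Poly_Mapping.keys p. f m \<noteq> 0}"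
    have fin: "finite K0" "finite K1" by (auto simp: K0_def K1_def)
    have split: "(\<Sum>m\<in>Poly_Mapping.keys p. g m) = (\<Sum>m\<in>K0. g m) + (\<Sum>m\<in>K1. g m)"
      for g :: "(nat \<Rightarrow>\<^sub>0 nat) \<Rightarrow> 'b::comm_monoid_add"
      by (subst sum.union_disjoint[symmetric]) (auto simp: K0_def K1_def intro!: sum.cong)
    have poly: "poly_at 2 p z = (\<Sum>m\<in>K0. c m * z 0 ^ e m)
        + (\<Sum>m\<in>K1. (c m * z 0 ^ e m) * z 1 ^ Suc (f m - 1))" for z
      unfolding poly_at_2 split by (auto simp: K0_def K1_def c_def e_def f_def mult_ac intro!: arg_cong2[where f="(+)"] sum.cong)
    define P0 Q where "P0 = (\<Sum>m\<in>K0. mat (c m) ** mpow (T 0) (e m))"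
      and "Q w = (\<Sum>m\<in>K1. (c m * a ^ e m) * w ^ (f m - 1))" for w
    have P: "poly_at_mats 2 p T = P0 + mat (Q b) ** T 1"
    proof -
      have "mat (c m) ** monom_at_mats 2 m T = mat (c m) ** mpow (T 0) (e m)" if "m \<in> K0" for m
        using that by (simp add: monom_at_mats_2 K0_def e_def f_def)
      moreover have "mat (c m) ** monom_at_mats 2 m T = mat ((c m * a ^ e m) * b ^ (f m - 1)) ** T 1"
        if "m \<in> K1" for m
      proof -
        have "monom_at_mats 2 m T = mpow (T 0) (e m) ** mpow (T 1) (Suc (f m - 1))"
          using that by (simp add: monom_at_mats_2 K1_def e_def f_def)
        also have "\<dots> = mpow (T 0) (e m) ** mat (b ^ (f m - 1)) ** T 1"
          unfolding pow1 by (simp only: matrix_mul_assoc)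
        also have "\<dots> = mat (b ^ (f m - 1)) ** (mat (a ^ e m) ** T 1)"
          unfolding mat_commute[symmetric] by (simp only: matrix_mul_assoc[symmetric] pow0)
        finally show ?thesis
          by (simp add: vec_eq_iff mat_matrix_mult_nth)
      qed
      moreover have "(\<Sum>m\<in>K1. mat ((c m * a ^ e m) * b ^ (f m - 1)) ** T 1) = mat (Q b) ** T 1"
        by (simp add: vec_eq_iff mat_matrix_mult_nth Q_def sum_distrib_right)
      ultimately show ?thesis
        unfolding poly_at_mats_def split P0_def by (simp add: c_def)
    qed
    have le_M: "cmod (poly_at 2 p z) \<le> M" if "z \<in> unit_ball 2" for z
      using poly_at_le_ball_sup[OF that] by (simp add: M_def)
    have "0 \<le> M" by (simp add: M_def ball_sup_nonneg)
    have "opnorm P0 \<le> M"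
      unfolding P0_def
    proof (rule von_Neumann_one_variable[where \<rho> = r])
      show "norm (ctranspose (T 0) *v x) \<le> r * norm x" for x
      proof (rule power2_le_imp_le)
        show "(norm (ctranspose (T 0) *v x))\<^sup>2 \<le> (r * norm x)\<^sup>2"
          unfolding power_mult_distrib by (rule order_trans[OF _ T[of x]]) simp
      qed (use r in simp)
      \<comment> \<open>the points of the circle lie on the boundary of the ball and are reached as limits\<close>
      show "cmod (\<Sum>m\<in>K0. c m * z ^ e m) \<le> M" if z: "cmod z = 1" for z
      proof -
        define t where "t n = 1 - inverse (real (Suc n))" for n
        have "t \<longlonglongrightarrow> 1 - 0"
          unfolding t_def by (intro tendsto_diff tendsto_const LIMSEQ_inverse_real_of_nat)
        then have "(\<lambda>n. cmod (\<Sum>m\<in>K0. c m * (of_real (t n) * z) ^ e m)) \<longlonglongrightarrow> cmod (\<Sum>m\<in>K0. c m * (of_real (1 - 0) * z) ^ e m)"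
          by (intro tendsto_intros)
        moreover have "cmod (\<Sum>m\<in>K0. c m * (of_real (t n) * z) ^ e m) \<le> M" for n
        proof -
          have "0 \<le> t n" "t n < 1" by (auto simp: t_def field_simps)
          then have "(\<lambda>j. if j = 0 then of_real (t n) * z else 0) \<in> unit_ball 2"
            using z by (simp add: unit_ball_2 norm_mult power_less_one_iff)
          from le_M[OF this] show ?thesis by (simp add: poly)
        qed
        ultimately have "cmod (\<Sum>m\<in>K0. c m * (of_real (1 - 0) * z) ^ e m) \<le> M"
          by (intro LIMSEQ_le_const2) auto
        then show ?thesis by simp
      qed
    qed (use r fin in auto)
    define s where "s = norm (ctranspose (T 1) *v axis i 1)"
    define t where "t = sqrt (r\<^sup>2 - (cmod a)\<^sup>2)"
    have "cmod a \<le> norm (ctranspose (T 0) *v axis i 1)" "cmod b \<le> s"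
      using Finite_Cartesian_Product.norm_nth_le[of "ctranspose (T 0) *v axis i 1" i]
        Finite_Cartesian_Product.norm_nth_le[of "ctranspose (T 1) *v axis i 1" i]
      by (simp_all add: ctranspose_axis_nth a_def b_def s_def)
    then have "(cmod a)\<^sup>2 \<le> (norm (ctranspose (T 0) *v axis i 1))\<^sup>2"
      by (intro power_mono) auto
    moreover have "(norm (ctranspose (T 0) *v axis i 1))\<^sup>2 + s\<^sup>2 \<le> r\<^sup>2"
      using T[of "axis i 1"] by (simp add: s_def)
    ultimately have as: "(cmod a)\<^sup>2 + s\<^sup>2 \<le> r\<^sup>2" by linarith
    then have "s \<le> t"
      unfolding t_def by (intro real_le_rsqrt) auto
    have "0 \<le> r\<^sup>2 - (cmod a)\<^sup>2"
      using as zero_le_power2[of s] by linarith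
    then have t: "(cmod a)\<^sup>2 + t\<^sup>2 = r\<^sup>2" "0 \<le> s"
      by (auto simp: t_def s_def)
    have r1: "r\<^sup>2 < 1"
      using r by (simp add: power_less_one_iff)
    have Qb: "cmod (Q b) * s \<le> 2 * M"
    proof (cases "s = 0")
      case True
      then show ?thesis using \<open>0 \<le> M\<close> by simp
    next
      case False
      then have "0 < t" using t \<open>s \<le> t\<close> by linarith
      have "cmod (Q b) * t \<le> 2 * M"
        unfolding Q_def
      proof (rule max_modulus_quotient)
        fix w assume w: "cmod w = t"
        let ?z = "\<lambda>w j. if j = (0::nat) then a else w"
        have "(\<Sum>m\<in>K1. c m * a ^ e m * w ^ Suc (f m - 1)) = poly_at 2 p (?z w) - poly_at 2 p (?z 0)"
          unfolding poly by simp
        also have "cmod \<dots> \<le> cmod (poly_at 2 p (?z w)) + cmod (poly_at 2 p (?z 0))"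
          by (rule norm_triangle_ineq4)
        also have "\<dots> \<le> M + M"
        proof -
          have "(cmod a)\<^sup>2 + (cmod w)\<^sup>2 < 1" "(cmod a)\<^sup>2 < 1"
            using t(1) r1 zero_le_power2[of t] unfolding w by linarith+
          then show ?thesis
            by (intro add_mono le_M) (simp_all add: unit_ball_2)
        qed
        finally show "cmod (\<Sum>m\<in>K1. c m * a ^ e m * w ^ Suc (f m - 1)) \<le> 2 * M" by simp
      qed (use \<open>0 < t\<close> \<open>cmod b \<le> s\<close> \<open>s \<le> t\<close> fin in auto)
      moreover have "cmod (Q b) * s \<le> cmod (Q b) * t"
        using \<open>s \<le> t\<close> by (intro mult_left_mono) auto
      ultimately show ?thesis by linarith
    qed
    have T1: "norm (T 1 *v x) \<le> s * norm x" for x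
    proof -
      have "(T 1 *v x) $ j = 0" if "j \<noteq> i" for j
        using row[OF that] by (simp add: matrix_vector_mult_def T_def)
      then have "T 1 *v x = (T 1 *v x) $ i *s axis i 1"
        by (auto simp: vec_eq_iff axis_def)
      then have "norm (T 1 *v x) = norm ((T 1 *v x) $ i *s axis i 1)"
        by (rule arg_cong)
      also have "\<dots> = cmod ((T 1 *v x) $ i)"
        by (simp add: norm_scale)
      also have "(T 1 *v x) $ i = hdot (ctranspose (T 1) *v axis i 1) x"
        by (simp add: hdot_ctranspose hdot_axis)
      finally show ?thesis
        using hdot_Cauchy_Schwarz by (simp add: s_def)
    qed
    show "opnorm (poly_at_mats 2 p T) \<le> 3 * ball_sup 2 p"
      unfolding opnorm_le_iff M_def[symmetric]
    proof
      fix x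
      have "norm (poly_at_mats 2 p T *v x) \<le> norm (P0 *v x) + cmod (Q b) * norm (T 1 *v x)"
        unfolding P matrix_vector_mult_add_rdistrib
        by (rule order_trans[OF norm_triangle_ineq])
          (simp add: matrix_vector_mul_assoc[symmetric] mat_vector_mult norm_scale)
      also have "\<dots> \<le> M * norm x + cmod (Q b) * (s * norm x)"
        using \<open>opnorm P0 \<le> M\<close> T1 by (intro add_mono mult_left_mono) (auto simp: opnorm_le_iff)
      also have "\<dots> \<le> M * norm x + 2 * M * norm x"
        using mult_right_mono[OF Qb norm_ge_zero[of x]] by (simp add: mult_ac)
      finally show "norm (poly_at_mats 2 p T *v x) \<le> 3 * M * norm x" by simp
    qed
  qed
qed

section \<open>Automorphisms of the ball\<close>

lemma ctranspose_diff: "ctranspose (A - B) = ctranspose A - ctranspose B"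
  by (simp add: vec_eq_iff)

lemma ctranspose_sum: "ctranspose (\<Sum>j\<in>J. F j) = (\<Sum>j\<in>J. ctranspose (F j))"
  by (simp add: vec_eq_iff)

lemma ctranspose_mat_mult: "ctranspose (mat c ** A) = mat (cnj c) ** ctranspose A"
  by (simp add: ctranspose_mult mat_commute)

lemma norm_diff_square: "(norm (x - y))\<^sup>2 = (norm x)\<^sup>2 - 2 * Re (hdot x y) + (norm y)\<^sup>2"
  by (simp add: power2_norm_eq_inner Re_hdot inner_diff inner_commute)

lemma matrix_diff_mult: "(A - B) ** C = A ** C - B ** (C :: complex^'n^'n)"
  by (simp add: vec_eq_iff matrix_matrix_mult_def algebra_simps sum_subtractf)

lemma matrix_mult_diff: "C ** (A - B) = C ** A - C ** (B :: complex^'n^'n)"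
  by (simp add: vec_eq_iff matrix_matrix_mult_def algebra_simps sum_subtractf)

lemma commute_sum:
  fixes X :: "complex^'n^'n"
  shows "(\<And>j. j \<in> J \<Longrightarrow> X ** F j = F j ** X) \<Longrightarrow> X ** (\<Sum>j\<in>J. F j) = (\<Sum>j\<in>J. F j) ** X"
  by (simp add: matrix_mult_sum_right matrix_sum_mult)

lemma commute_scale:
  fixes X :: "complex^'n^'n"
  assumes "X ** Y = Y ** X"
  shows "X ** (mat c ** Y) = (mat c ** Y) ** X"
  using assms mat_commute[of c X] by (metis matrix_mul_assoc)

lemma commute_diff:
  fixes X :: "complex^'n^'n"
  shows "X ** Y = Y ** X \<Longrightarrow> X ** Z = Z ** X \<Longrightarrow> X ** (Y - Z) = (Y - Z) ** X"
  by (simp add: matrix_diff_mult matrix_mult_diff)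

text \<open>
  The Cauchy--Schwarz inequality for the column of adjoints.
\<close>

lemma row_combination_bound:
  assumes "row_contractive d T"
  shows "norm (ctranspose (\<Sum>j<d. mat (cnj (a j)) ** T j) *v x) \<le> sqrt (\<Sum>j<d. (cmod (a j))\<^sup>2) * norm x"
proof -
  have "ctranspose (\<Sum>j<d. mat (cnj (a j)) ** T j) *v x = (\<Sum>j<d. a j *s (ctranspose (T j) *v x))"
    by (simp add: ctranspose_sum ctranspose_mat_mult sum_matrix_vector_mult mat_vector_mult
        flip: matrix_vector_mul_assoc)
  also have "norm \<dots> \<le> (\<Sum>j<d. \<bar>cmod (a j)\<bar> * \<bar>norm (ctranspose (T j) *v x)\<bar>)"
    by (rule sum_norm_le) (simp add: norm_scale)
  also have "\<dots> \<le> L2_set (\<lambda>j. cmod (a j)) {..<d} * L2_set (\<lambda>j. norm (ctranspose (T j) *v x)) {..<d}"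
    by (rule L2_set_mult_ineq)
  also have "\<dots> \<le> L2_set (\<lambda>j. cmod (a j)) {..<d} * norm x"
    using assms by (intro mult_left_mono L2_set_nonneg) (auto simp: row_contractive_iff L2_set_def intro!: real_le_lsqrt)
  finally show ?thesis by (simp add: L2_set_def)
qed

text \<open>
  The identity behind all properties of the automorphisms of the ball. With \<open>v j\<close> the
  images of \<open>x\<close> under the adjoints of a tuple it shows that row contractivity is
  preserved; in the one-dimensional case it shows that the ball is.
\<close>

lemma moebius_norm_identity:
  fixes x :: "complex^'n" and v :: "nat \<Rightarrow> complex^'n"
  assumes s: "s\<^sup>2 = 1 - (\<Sum>j<d. (cmod (a j))\<^sup>2)" "0 < s"
    and w: "w = (\<Sum>j<d. a j *s v j)"
  shows "(\<Sum>j<d. (norm (cnj (a j) *s (x - of_real (1 / (1 + s)) *s w) - of_real s *s v j))\<^sup>2)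
    = (norm (x - w))\<^sup>2 - s\<^sup>2 * ((norm x)\<^sup>2 - (\<Sum>j<d. (norm (v j))\<^sup>2))"
proof -
  define \<kappa> where "\<kappa> = 1 / (1 + s)"
  have \<kappa>: "\<kappa> * (1 + s) = 1" using s(2) by (simp add: \<kappa>_def)
  define y where "y = x - of_real \<kappa> *s w"
  have "(norm (cnj (a j) *s y - of_real s *s v j))\<^sup>2
      = (cmod (a j))\<^sup>2 * (norm y)\<^sup>2 - 2 * s * Re (hdot y (a j *s v j)) + s\<^sup>2 * (norm (v j))\<^sup>2" for j
    using s(2) by (simp add: norm_diff_square norm_scale power_mult_distrib hdot_scale)
  then have "(\<Sum>j<d. (norm (cnj (a j) *s y - of_real s *s v j))\<^sup>2)
      = (1 - s\<^sup>2) * (norm y)\<^sup>2 - 2 * s * Re (hdot y w) + s\<^sup>2 * (\<Sum>j<d. (norm (v j))\<^sup>2)"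
    using s(1) by (simp add: sum.distrib sum_subtractf sum_distrib_left[symmetric]
        sum_distrib_right[symmetric] w hdot_sum Re_sum[symmetric] del: Re_sum)
  moreover have "(norm y)\<^sup>2 = (norm x)\<^sup>2 - 2 * (\<kappa> * Re (hdot x w)) + \<kappa>\<^sup>2 * (norm w)\<^sup>2"
    by (simp add: y_def norm_diff_square hdot_scale norm_scale power_mult_distrib)
  moreover have "Re (hdot y w) = Re (hdot x w) - \<kappa> * (norm w)\<^sup>2"
    by (simp add: y_def hdot_diff hdot_scale hdot_self)
  moreover have "(norm (x - w))\<^sup>2 = (norm x)\<^sup>2 - 2 * Re (hdot x w) + (norm w)\<^sup>2"
    by (rule norm_diff_square)
  moreover have "(1 - s\<^sup>2) * (X - 2 * (\<kappa> * Y) + \<kappa>\<^sup>2 * W) - 2 * s * (Y - \<kappa> * W) + s\<^sup>2 * V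
      = X - 2 * Y + W - s\<^sup>2 * (X - V)" for X Y W V :: real
    using \<kappa> by algebra
  ultimately show ?thesis
    unfolding \<kappa>_def[symmetric] y_def[symmetric] by simp
qed

text \<open>
  The numerators of the automorphism of the ball that exchanges \<open>0\<close> and \<open>a\<close>,
  the common denominator being \<open>1 - \<langle>z, a\<rangle>\<close>. With \<open>P\<close> the
  projection onto the line of \<open>a\<close> and \<open>Q = 1 - P\<close>, the usual expression
  \<open>a - P z - s Q z\<close> becomes this one because \<open>(1 - s) / \<bar>a\<bar>\<^sup>2 = 1
  / (1 + s)\<close>; written like this it makes sense for \<open>a = 0\<close> as well.
\<close>

definition moebius_scalar :: "nat \<Rightarrow> (nat \<Rightarrow> complex) \<Rightarrow> real \<Rightarrow> nat \<Rightarrow> (nat \<Rightarrow> complex) \<Rightarrow> complex" where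
  "moebius_scalar d a s j z = a j * (1 - of_real (1 / (1 + s)) * (\<Sum>k<d. cnj (a k) * z k)) - of_real s * z j"

definition moebius_matrix ::
    "nat \<Rightarrow> (nat \<Rightarrow> complex) \<Rightarrow> real \<Rightarrow> nat \<Rightarrow> (nat \<Rightarrow> complex^'n^'n) \<Rightarrow> complex^'n^'n" where
  "moebius_matrix d a s j T = mat (a j) ** (mat 1 - mat (of_real (1 / (1 + s))) ** (\<Sum>k<d. mat (cnj (a k)) ** T k))
    - mat (of_real s) ** T j"

lemma moebius_matrix_adjoint:
  assumes s: "s\<^sup>2 = 1 - (\<Sum>j<d. (cmod (a j))\<^sup>2)" "0 < s"
  shows "(\<Sum>j<d. (norm (ctranspose (moebius_matrix d a s j T) *v x))\<^sup>2)
    = (norm (ctranspose (mat 1 - (\<Sum>k<d. mat (cnj (a k)) ** T k)) *v x))\<^sup>2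
      - s\<^sup>2 * ((norm x)\<^sup>2 - (\<Sum>j<d. (norm (ctranspose (T j) *v x))\<^sup>2))"
proof -
  define w where "w = (\<Sum>j<d. a j *s (ctranspose (T j) *v x))"
  have A: "ctranspose (\<Sum>j<d. mat (cnj (a j)) ** T j) *v x = w"
    by (simp add: w_def ctranspose_sum ctranspose_mat_mult sum_matrix_vector_mult mat_vector_mult
        flip: matrix_vector_mul_assoc)
  have "ctranspose (moebius_matrix d a s j T) *v x
      = cnj (a j) *s (x - of_real (1 / (1 + s)) *s w) - of_real s *s (ctranspose (T j) *v x)" for j
    by (simp add: moebius_matrix_def ctranspose_diff ctranspose_mat_mult matrix_vector_mult_diff_rdistrib
        mat_vector_mult A flip: matrix_vector_mul_assoc)
  then show ?thesis
    using moebius_norm_identity[OF s w_def, of x]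
    by (simp add: ctranspose_diff matrix_vector_mult_diff_rdistrib A)
qed

lemma moebius_scalar_norm:
  assumes s: "s\<^sup>2 = 1 - (\<Sum>j<d. (cmod (a j))\<^sup>2)" "0 < s"
  shows "(\<Sum>j<d. (cmod (moebius_scalar d a s j z))\<^sup>2)
    = (cmod (1 - (\<Sum>k<d. cnj (a k) * z k)))\<^sup>2 - s\<^sup>2 * (1 - (\<Sum>j<d. (cmod (z j))\<^sup>2))"
proof -
  define e where "e = (axis 1 1 :: complex^1)"
  define \<zeta> where "\<zeta> = (\<Sum>k<d. cnj (a k) * z k)"
  have [simp]: "norm e = 1" by (simp add: e_def)
  have "(\<Sum>j<d. a j *s (cnj (z j) *s e)) = cnj \<zeta> *s e"
    by (simp add: \<zeta>_def vec_eq_iff sum_distrib_left mult_ac)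
  note id = moebius_norm_identity[OF s this[symmetric], of e]
  have "norm (cnj (a j) *s (e - of_real (1 / (1 + s)) *s (cnj \<zeta> *s e)) - of_real s *s (cnj (z j) *s e))
      = cmod (moebius_scalar d a s j z)" for j
  proof -
    have "cnj (a j) *s (e - of_real (1 / (1 + s)) *s (cnj \<zeta> *s e)) - of_real s *s (cnj (z j) *s e)
        = cnj (moebius_scalar d a s j z) *s e"
      unfolding moebius_scalar_def \<zeta>_def[symmetric] by (simp add: vec_eq_iff algebra_simps)
    then show ?thesis by (simp add: norm_scale)
  qed
  moreover have "norm (e - cnj \<zeta> *s e) = cmod (1 - \<zeta>)"
  proof -
    have "e - cnj \<zeta> *s e = cnj (1 - \<zeta>) *s e"
      by (simp add: vec_eq_iff algebra_simps)
    then show ?thesis by (simp add: norm_scale del: complex_cnj_diff)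
  qed
  moreover have "norm (cnj (z j) *s e) = cmod (z j)" for j
    by (simp add: norm_scale)
  ultimately show ?thesis
    using id by (simp add: \<zeta>_def[symmetric])
qed


lemma moebius_pair:
  assumes "j < d"
  shows "poly_eval_pair d (moebius_scalar d a s j) (moebius_matrix d a s j :: (nat \<Rightarrow> complex^'n^'n) \<Rightarrow> _)"
proof -
  have diff: "poly_eval_pair d (\<lambda>z. f z - g z) (\<lambda>T. F T - G T)"
    if "poly_eval_pair d f F" "poly_eval_pair d g G" for f g and F G :: "(nat \<Rightarrow> complex^'n^'n) \<Rightarrow> complex^'n^'n"
  proof -
    have "poly_eval_pair d (\<lambda>z. f z + (-1) * g z) (\<lambda>T. F T + mat (-1) ** G T)"
      by (intro poly_eval_pair_add poly_eval_pair_mult poly_eval_pair_const that)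
    moreover have "mat (-1) ** A = - A" for A :: "complex^'n^'n"
      by (simp add: vec_eq_iff mat_matrix_mult_nth)
    ultimately show ?thesis by simp
  qed
  show ?thesis
    unfolding moebius_scalar_def[abs_def] moebius_matrix_def[abs_def]
    by (intro diff poly_eval_pair_mult poly_eval_pair_const poly_eval_pair_sum
        poly_eval_pair_coordinate assms) auto
qed

lemma mat_minus_mult_geometric:
  fixes A :: "complex^'n^'n"
  shows "(mat 1 - A) ** (\<Sum>k<n. mpow A k) = mat 1 - mpow A n"
  by (induction n) (simp_all add: matrix_add_ldistrib matrix_diff_mult)

lemma mat_of_real_mult: "mat (of_real r) ** A = r *\<^sub>R (A :: complex^'n^'n)"
  unfolding vec_eq_iff mat_matrix_mult_nth vector_scaleR_component
  by (simp add: scaleR_conv_of_real)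

lemma mpow_tendsto_0:
  fixes A :: "complex^'n^'n"
  assumes "0 \<le> \<rho>" "\<rho> < 1" "\<And>x. norm (ctranspose A *v x) \<le> \<rho> * norm x"
  shows "(\<lambda>n. mpow A n) \<longlonglongrightarrow> 0"
proof (intro vec_tendstoI)
  fix i j
  have bound: "norm (ctranspose (mpow A n) *v x) \<le> \<rho> ^ n * norm x" for n x
  proof (induction n)
    case (Suc n)
    have "norm (ctranspose (mpow A (Suc n)) *v x) = norm (ctranspose A *v (ctranspose (mpow A n) *v x))"
      unfolding ctranspose_mpow by (simp only: mpow.simps matrix_vector_mul_assoc)
    also have "\<dots> \<le> \<rho> * (\<rho> ^ n * norm x)"
      using assms(3) Suc \<open>0 \<le> \<rho>\<close> by (meson mult_left_mono order_trans)
    finally show ?case by (simp add: mult_ac)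
  qed simp
  have "cmod (mpow A n $ i $ j) \<le> \<rho> ^ n" for n
    using Finite_Cartesian_Product.norm_nth_le[of "ctranspose (mpow A n) *v axis i 1" j] bound[of n "axis i 1"]
    by (simp add: ctranspose_axis_nth)
  then have "(\<lambda>n. mpow A n $ i $ j) \<longlonglongrightarrow> 0"
    by (intro Lim_null_comparison[OF always_eventually LIMSEQ_realpow_zero[OF assms(1,2)]]) auto
  then show "(\<lambda>n. mpow A n $ i $ j) \<longlonglongrightarrow> (0 :: complex^'n^'n) $ i $ j"
    by simp
qed

text \<open>
  Truncating the geometric series of \<open>1 / (1 - \<zeta>)\<close> with \<open>\<zeta> =
  \<langle>z, a\<rangle>\<close> multiplies the automorphism by \<open>1 - \<zeta>\<^sup>n\<close>,
  whose modulus is at most \<open>1 + \<rho>\<^sup>n\<close>. Dividing by this number gives a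
  polynomial map of the ball into itself.
\<close>

lemma moebius_approximation_in_ball:
  assumes s: "s\<^sup>2 = 1 - (\<Sum>j<d. (cmod (a j))\<^sup>2)" "0 < s"
    and z: "z \<in> unit_ball d"
  defines "\<rho> \<equiv> sqrt (\<Sum>j<d. (cmod (a j))\<^sup>2)"
  shows "(\<lambda>j. of_real (1 / (1 + \<rho> ^ n)) * (moebius_scalar d a s j z * (\<Sum>k<n. (\<Sum>l<d. cnj (a l) * z l) ^ k)))
    \<in> unit_ball d"
proof -
  define \<zeta> where "\<zeta> = (\<Sum>l<d. cnj (a l) * z l)"
  define g where "g = (\<Sum>k<n. \<zeta> ^ k)"
  have "0 \<le> \<rho>" by (simp add: \<rho>_def sum_nonneg)
  have z1: "(\<Sum>j<d. (cmod (z j))\<^sup>2) < 1" using z by (simp add: unit_ball_def)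
  have "cmod \<zeta> \<le> (\<Sum>l<d. \<bar>cmod (a l)\<bar> * \<bar>cmod (z l)\<bar>)"
    unfolding \<zeta>_def by (rule sum_norm_le) (simp add: norm_mult)
  also have "\<dots> \<le> L2_set (\<lambda>l. cmod (a l)) {..<d} * L2_set (\<lambda>l. cmod (z l)) {..<d}"
    by (rule L2_set_mult_ineq)
  also have "\<dots> \<le> \<rho> * 1"
    using z1 by (intro mult_mono) (auto simp: L2_set_def \<rho>_def sum_nonneg)
  finally have \<zeta>: "cmod \<zeta> ^ n \<le> \<rho> ^ n"
    by (intro power_mono) auto
  have "(1 - \<zeta>) * g = 1 - \<zeta> ^ n"
    unfolding g_def by (rule one_diff_power_eq[symmetric])
  then have "cmod (1 - \<zeta>) * cmod g = cmod (1 - \<zeta> ^ n)"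
    by (metis norm_mult)
  also have "\<dots> \<le> 1 + \<rho> ^ n"
    using norm_triangle_ineq4[of 1 "\<zeta> ^ n"] \<zeta> by (simp add: norm_power)
  finally have g: "cmod (1 - \<zeta>) * cmod g \<le> 1 + \<rho> ^ n" .
  have pos: "0 < 1 + \<rho> ^ n" using \<open>0 \<le> \<rho>\<close> by (simp add: add_pos_nonneg)
  have "(\<Sum>j<d. (cmod (of_real (1 / (1 + \<rho> ^ n)) * (moebius_scalar d a s j z * g)))\<^sup>2)
      = (\<Sum>j<d. (cmod (moebius_scalar d a s j z))\<^sup>2) * ((cmod g)\<^sup>2 / (1 + \<rho> ^ n)\<^sup>2)"
    unfolding sum_distrib_right using pos
    by (intro sum.cong refl) (simp only: norm_mult norm_of_real abs_divide abs_of_pos power_mult_distrib power_divide, simp)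
  also have "\<dots> < 1"
  proof (cases "g = 0")
    case False
    have "s\<^sup>2 * (1 - (\<Sum>j<d. (cmod (z j))\<^sup>2)) > 0"
      using z1 s(2) by simp
    then have "(\<Sum>j<d. (cmod (moebius_scalar d a s j z))\<^sup>2) < (cmod (1 - \<zeta>))\<^sup>2"
      unfolding moebius_scalar_norm[OF s] \<zeta>_def by linarith
    then have "(\<Sum>j<d. (cmod (moebius_scalar d a s j z))\<^sup>2) * ((cmod g)\<^sup>2 / (1 + \<rho> ^ n)\<^sup>2)
        < (cmod (1 - \<zeta>))\<^sup>2 * ((cmod g)\<^sup>2 / (1 + \<rho> ^ n)\<^sup>2)"
      using False pos by (intro mult_strict_right_mono) auto
    also have "\<dots> = (cmod (1 - \<zeta>) * cmod g / (1 + \<rho> ^ n))\<^sup>2"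
      by (simp add: power_mult_distrib power_divide)
    also have "\<dots> \<le> 1"
      using g pos by (intro power_le_one) auto
    finally show ?thesis .
  qed simp
  finally show ?thesis
    unfolding unit_ball_def g_def \<zeta>_def by simp
qed

text \<open>
  Let \<open>S\<close> be the image of \<open>T\<close> under the automorphism. As the automorphism is
  an involution, \<open>T\<close> is in turn the image of \<open>S\<close>, hence the limit of the
  images of \<open>S\<close> under the polynomial maps of
  \<open>moebius_approximation_in_ball\<close>, and a bound for \<open>S\<close> is inherited by
  \<open>T\<close>.
\<close>

lemma satisfies_vN_moebius:
  fixes T :: "nat \<Rightarrow> complex^'n^'n"
  assumes comm: "commuting_tuple d T" and contr: "row_contractive d T"
    and s: "s\<^sup>2 = 1 - (\<Sum>j<d. (cmod (a j))\<^sup>2)" "0 < s" and "0 \<le> C"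
  obtains S where "commuting_tuple d S" "row_contractive d S"
    "\<And>j. j < d \<Longrightarrow> (mat 1 - (\<Sum>k<d. mat (cnj (a k)) ** T k)) ** S j = moebius_matrix d a s j T"
    "satisfies_vN d S C \<Longrightarrow> satisfies_vN d T C"
proof -
  define \<rho> where "\<rho> = sqrt (\<Sum>j<d. (cmod (a j))\<^sup>2)"
  have \<rho>: "0 \<le> \<rho>" "\<rho> < 1"
  proof -
    have "(\<Sum>j<d. (cmod (a j))\<^sup>2) < 1" using s zero_less_power[OF s(2), of 2] by linarith
    then show "\<rho> < 1" by (simp add: \<rho>_def)
  qed (simp add: \<rho>_def sum_nonneg)
  define A where "A = (\<Sum>k<d. mat (cnj (a k)) ** T k)"
  define D where "D = mat 1 - A"
  define N where "N j = moebius_matrix d a s j T" for j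
  have N: "N j = mat (a j) ** (mat 1 - mat (of_real (1 / (1 + s))) ** A) - mat (of_real s) ** T j" for j
    by (simp only: N_def moebius_matrix_def A_def)
  have commN: "X ** N j = N j ** X" if "\<And>k. k < d \<Longrightarrow> X ** T k = T k ** X" "j < d" for X j
  proof -
    have "X ** A = A ** X"
      unfolding A_def using that by (intro commute_sum commute_scale) auto
    then show ?thesis
      unfolding N using that by (intro commute_diff commute_scale) auto
  qed
  have commD: "X ** D = D ** X" if "\<And>k. k < d \<Longrightarrow> X ** T k = T k ** X" for X
    unfolding D_def A_def using that by (intro commute_sum commute_diff commute_scale) auto
  have TT: "T j ** T k = T k ** T j" if "j < d" "k < d" for j k
    using comm that by (simp add: commuting_tuple_def)
  have DT: "D ** T k = T k ** D" if "k < d" for k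
    using commD[of "T k"] TT that by metis
  have NT: "N j ** T k = T k ** N j" if "j < d" "k < d" for j k
    using commN[of "T k" j] TT that by metis
  have DN: "D ** N j = N j ** D" and NN: "N k ** N j = N j ** N k" if "j < d" "k < d" for j k
    using commN DT NT that by blast+
  \<comment> \<open>a vector in the kernel is fixed by the adjoint of \<open>A\<close>, whose norm is at most \<open>\<rho> < 1\<close>\<close>
  have "inj ((*v) (ctranspose D))"
  proof (rule injI)
    fix x y assume eq: "ctranspose D *v x = ctranspose D *v y"
    define u where "u = x - y"
    have "ctranspose D *v u = 0"
      using eq by (simp add: u_def matrix_vector_mult_diff_distrib)
    then have "ctranspose A *v u = u"
      by (simp add: D_def ctranspose_diff matrix_vector_mult_diff_rdistrib)
    then have "norm u \<le> \<rho> * norm u"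
      using row_combination_bound[OF contr, of a u] by (simp add: A_def \<rho>_def)
    then have "norm u \<le> 0"
      using \<rho>(2) mult_less_cancel_right2[of \<rho> "norm u"] by (metis linorder_not_le norm_ge_zero not_le)
    then show "x = y" by (simp add: u_def)
  qed
  then obtain E' where "E' ** ctranspose D = mat 1"
    using matrix_left_invertible_injective by blast
  then have "ctranspose (E' ** ctranspose D) = mat 1" by simp
  then have DE: "D ** ctranspose E' = mat 1"
    by (simp add: ctranspose_mult)
  define E where "E = ctranspose E'"
  have DE: "D ** E = mat 1" and ED: "E ** D = mat 1"
    using DE matrix_left_right_inverse by (auto simp: E_def)
  have EX: "E ** X = X ** E" if "D ** X = X ** D" for X
  proof -
    have "E ** X = E ** (X ** D) ** E"
      by (simp only: matrix_mul_assoc[symmetric] DE matrix_mul_rid)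
    also have "\<dots> = (E ** D) ** X ** E"
      by (simp only: that[symmetric] matrix_mul_assoc)
    finally show ?thesis by (simp add: ED)
  qed
  define S where "S j = N j ** E" for j
  have SD: "S j ** D = N j" for j
    by (simp only: S_def matrix_mul_assoc[symmetric] ED matrix_mul_rid)
  have DS: "D ** S j = N j" if "j < d" for j
    using DN[OF that that] by (simp only: S_def matrix_mul_assoc) (simp only: matrix_mul_assoc[symmetric] DE matrix_mul_rid)
  have S_comm: "commuting_tuple d S"
    unfolding commuting_tuple_def
  proof (intro allI impI)
    fix i j assume ij: "i < d" "j < d"
    have "S i ** S j = N i ** (E ** N j) ** E"
      by (simp only: S_def matrix_mul_assoc)
    also have "\<dots> = (N i ** N j) ** E ** E"
      using EX[OF DN[OF ij(2,2)]] by (simp only: matrix_mul_assoc)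
    also have "\<dots> = N j ** (N i ** E) ** E"
      using NN[OF ij] by (simp only: matrix_mul_assoc)
    also have "\<dots> = N j ** (E ** N i) ** E"
      by (simp only: EX[OF DN[OF ij(1,1)]])
    also have "\<dots> = S j ** S i"
      by (simp only: S_def matrix_mul_assoc)
    finally show "S i ** S j = S j ** S i" .
  qed
  have S_contr: "row_contractive d S"
    unfolding row_contractive_iff
  proof
    fix x
    define y where "y = ctranspose E *v x"
    have y: "ctranspose D *v y = x"
      by (simp add: y_def matrix_vector_mul_assoc flip: ctranspose_mult) (simp add: ED)
    have "ctranspose (S j) *v x = ctranspose (N j) *v y" if "j < d" for j
      using DS[OF that] by (simp add: y[symmetric] matrix_vector_mul_assoc flip: ctranspose_mult)
    then have "(\<Sum>j<d. (norm (ctranspose (S j) *v x))\<^sup>2) = (\<Sum>j<d. (norm (ctranspose (N j) *v y))\<^sup>2)"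
      by simp
    also have "\<dots> = (norm x)\<^sup>2 - s\<^sup>2 * ((norm y)\<^sup>2 - (\<Sum>j<d. (norm (ctranspose (T j) *v y))\<^sup>2))"
      unfolding N_def moebius_matrix_adjoint[OF s] by (simp only: A_def[symmetric] D_def[symmetric] y)
    also have "\<dots> \<le> (norm x)\<^sup>2"
      using contr by (simp add: row_contractive_iff)
    finally show "(\<Sum>j<d. (norm (ctranspose (S j) *v x))\<^sup>2) \<le> (norm x)\<^sup>2" .
  qed
  define \<kappa> where "\<kappa> = complex_of_real (1 / (1 + s))"
  have \<kappa>: "\<kappa> * (1 + of_real s) = 1"
  proof -
    have "1 / (1 + s) * (1 + s) = 1" using s(2) by simp
    then have "complex_of_real (1 / (1 + s) * (1 + s)) = of_real 1" by (rule arg_cong)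
    then show ?thesis
      unfolding of_real_mult of_real_add of_real_1 \<kappa>_def .
  qed
  have \<alpha>: "(\<Sum>k<d. cnj (a k) * a k) = 1 - (of_real s)\<^sup>2"
  proof -
    have "(\<Sum>k<d. cnj (a k) * a k) = of_real (\<Sum>k<d. (cmod (a k))\<^sup>2)"
      by (simp add: mult.commute complex_norm_square del: of_real_power)
    also have "(\<Sum>k<d. (cmod (a k))\<^sup>2) = 1 - s\<^sup>2" using s(1) by simp
    finally show ?thesis by simp
  qed
  define B where "B = (\<Sum>k<d. mat (cnj (a k)) ** S k)"
  have BD: "B ** D = mat (1 - (of_real s)\<^sup>2) - A"
  proof -
    have "B ** D = (\<Sum>k<d. mat (cnj (a k)) ** N k)"
      unfolding B_def matrix_sum_mult by (simp only: matrix_mul_assoc[symmetric] SD)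
    moreover have "(\<Sum>k<d. mat (cnj (a k)) ** N k) $ i $ j = (mat (1 - (of_real s)\<^sup>2) - A) $ i $ j" for i j
    proof -
      have "(\<Sum>k<d. mat (cnj (a k)) ** N k) $ i $ j
          = (\<Sum>k<d. (cnj (a k) * a k) * (mat 1 $ i $ j - \<kappa> * A $ i $ j) - of_real s * (cnj (a k) * T k $ i $ j))"
        unfolding N \<kappa>_def[symmetric] by (simp add: mat_matrix_mult_nth algebra_simps)
      also have "\<dots> = (1 - (of_real s)\<^sup>2) * (mat 1 $ i $ j - \<kappa> * A $ i $ j) - of_real s * A $ i $ j"
        by (simp add: sum_subtractf sum_distrib_right[symmetric] \<alpha> sum_distrib_left[symmetric])
          (simp add: A_def mat_matrix_mult_nth)
      also have "\<dots> = (1 - (of_real s)\<^sup>2) * mat 1 $ i $ j - A $ i $ j"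
        using \<kappa> by algebra
      finally show ?thesis by (simp add: mat_def)
    qed
    ultimately show ?thesis by (simp add: vec_eq_iff)
  qed
  \<comment> \<open>the denominators of the automorphism at \<open>S\<close> and at \<open>T\<close> are inverse to each other up to the factor \<open>s\<^sup>2\<close>\<close>
  have IB: "mat 1 - B = mat ((of_real s)\<^sup>2) ** E"
  proof -
    have "(mat 1 - B) ** D = mat ((of_real s)\<^sup>2)"
      unfolding matrix_diff_mult BD matrix_mul_lid by (simp add: D_def vec_eq_iff mat_def)
    then have "(mat 1 - B) ** D ** E = mat ((of_real s)\<^sup>2) ** E" by simp
    then show ?thesis by (simp only: matrix_mul_assoc[symmetric] DE matrix_mul_rid)
  qed
  have NS: "moebius_matrix d a s j S = T j ** (mat 1 - B)" if "j < d" for j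
  proof -
    let ?M = "moebius_matrix d a s j S"
    have "?M ** D = mat (a j) ** (D - mat \<kappa> ** (B ** D)) - mat (of_real s) ** N j"
      unfolding moebius_matrix_def \<kappa>_def[symmetric] B_def[symmetric]
      by (simp only: matrix_diff_mult matrix_mult_diff matrix_mul_assoc[symmetric] SD matrix_mul_lid)
    also have "\<dots> = mat ((of_real s)\<^sup>2) ** T j"
    proof -
      have "(mat (a j) ** (D - mat \<kappa> ** (B ** D)) - mat (of_real s) ** N j) $ i $ k
          = a j * (mat 1 $ i $ k - A $ i $ k - \<kappa> * ((1 - (of_real s)\<^sup>2) * mat 1 $ i $ k - A $ i $ k))
            - of_real s * (a j * (mat 1 $ i $ k - \<kappa> * A $ i $ k) - of_real s * T j $ i $ k)" for i k
        unfolding BD unfolding N \<kappa>_def[symmetric] D_def by (simp add: mat_matrix_mult_nth) (simp add: mat_def)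
      moreover have "\<dots> i k = (of_real s)\<^sup>2 * T j $ i $ k" for i k
        using \<kappa> by algebra
      ultimately show ?thesis
        by (simp add: vec_eq_iff mat_matrix_mult_nth)
    qed
    finally have "?M ** D ** E = mat ((of_real s)\<^sup>2) ** T j ** E" by simp
    then have "?M = T j ** (mat ((of_real s)\<^sup>2) ** E)"
      by (simp only: matrix_mul_assoc[symmetric] DE matrix_mul_rid) (simp only: matrix_mul_assoc mat_commute[of _ "T j"])
    then show ?thesis by (simp only: IB)
  qed
  have "satisfies_vN d T C" if "satisfies_vN d S C"
  proof (rule satisfies_vN_limit)
    let ?G = "\<lambda>n j (S :: nat \<Rightarrow> complex^'n^'n). mat (of_real (1 / (1 + \<rho> ^ n))) **
      (moebius_matrix d a s j S ** (\<Sum>k<n. mpow (\<Sum>l<d. mat (cnj (a l)) ** S l) k))"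
    show "satisfies_vN d (\<lambda>j. ?G n j S) C" for n
    proof (rule satisfies_vN_polynomial_image[OF that S_comm \<open>0 \<le> C\<close>])
      show "poly_eval_pair d (\<lambda>z. of_real (1 / (1 + \<rho> ^ n)) * (moebius_scalar d a s j z * (\<Sum>k<n. (\<Sum>l<d. cnj (a l) * z l) ^ k))) (?G n j)"
        if "j < d" for j
        by (intro poly_eval_pair_mult poly_eval_pair_const poly_eval_pair_sum moebius_pair that
            poly_eval_pair_power poly_eval_pair_coordinate) auto
      show "(\<lambda>j. of_real (1 / (1 + \<rho> ^ n)) * (moebius_scalar d a s j z * (\<Sum>k<n. (\<Sum>l<d. cnj (a l) * z l) ^ k))) \<in> unit_ball d"
        if "z \<in> unit_ball d" for z
        using moebius_approximation_in_ball[OF s that] by (simp only: \<rho>_def)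
    qed
    fix j assume "j < d"
    have G: "?G n j S = (1 / (1 + \<rho> ^ n)) *\<^sub>R (T j ** (mat 1 - mpow B n))" for n
    proof -
      have "moebius_matrix d a s j S ** (\<Sum>k<n. mpow B k) = T j ** (mat 1 - mpow B n)"
        unfolding NS[OF \<open>j < d\<close>] matrix_mul_assoc[symmetric] mat_minus_mult_geometric ..
      then have "?G n j S = mat (of_real (1 / (1 + \<rho> ^ n))) ** (T j ** (mat 1 - mpow B n))"
        by (simp only: B_def)
      then show ?thesis
        by (simp only: mat_of_real_mult)
    qed
    have "(\<lambda>n. mpow B n) \<longlonglongrightarrow> 0"
      using row_combination_bound[OF S_contr] by (intro mpow_tendsto_0[OF \<rho>]) (simp add: B_def \<rho>_def)
    then have "(\<lambda>n. (1 / (1 + \<rho> ^ n)) *\<^sub>R (T j ** (mat 1 - mpow B n))) \<longlonglongrightarrow> (1 / (1 + 0)) *\<^sub>R (T j ** (mat 1 - 0))"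
      by (intro tendsto_scaleR tendsto_divide tendsto_add tendsto_const LIMSEQ_realpow_zero[OF \<rho>]
          tendsto_matrix_mult tendsto_diff) auto
    then show "(\<lambda>n. ?G n j S) \<longlonglongrightarrow> T j"
      unfolding G by simp
  qed
  with S_comm S_contr DS show ?thesis
    using that by (simp add: D_def A_def N_def)
qed

section \<open>Simultaneous unitary triangularization\<close>

lemma exists_linear_relation:
  fixes u :: "nat \<Rightarrow> complex^'n"
  obtains c where "\<exists>i\<le>CARD('n). c i \<noteq> 0" "(\<Sum>i\<le>CARD('n). c i *s u i) = 0"
proof (cases "inj_on u {..CARD('n)}")
  case False
  then obtain i j where ij: "i \<le> CARD('n)" "j \<le> CARD('n)" "i \<noteq> j" "u i = u j"
    by (auto simp: inj_on_def)
  define c :: "nat \<Rightarrow> complex" where "c k = (if k = i then 1 else 0) - (if k = j then 1 else 0)" for k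
  have "(\<Sum>k\<le>CARD('n). c k *s u k) = (\<Sum>k\<le>CARD('n). (if k = i then u k else 0) - (if k = j then u k else 0))"
    by (intro sum.cong refl) (simp add: c_def)
  also have "\<dots> = 0"
    using ij by (simp add: sum_subtractf)
  finally have "(\<Sum>k\<le>CARD('n). c k *s u k) = 0" .
  moreover have "c i \<noteq> 0" using ij(3) by (simp add: c_def)
  ultimately show ?thesis
    using that[of c] ij(1) by blast
next
  case True
  define B where "B = u ` {..CARD('n)}"
  have "card B = Suc CARD('n)"
    using True by (simp add: B_def card_image)
  then have "vec.dependent B"
    using vec.dependent_biggerset_general[of B] vec.dim_subset_UNIV[of B] by (simp add: B_def vec.dimension_def card_cart_basis)
  then obtain f where f: "\<exists>v\<in>B. f v \<noteq> 0" "(\<Sum>v\<in>B. f v *s v) = 0"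
    using vec.dependent_finite[of B] by (auto simp: B_def)
  have "(\<Sum>i\<le>CARD('n). f (u i) *s u i) = 0"
    using f(2) True by (simp add: B_def sum.reindex)
  then show ?thesis
    using that[of "\<lambda>i. f (u i)"] f(1) by (auto simp: B_def)
qed

text \<open>
  Split off a linear factor \<open>X - l\<close> of the annihilating polynomial of \<open>v\<close>.
  Either \<open>(A - l) v\<close> vanishes and \<open>v\<close> is an eigenvector, or it is a
  nonzero vector of \<open>V\<close> annihilated by the quotient, which has smaller degree.
\<close>

lemma eigenvector_of_annihilator:
  fixes A :: "complex^'n^'n"
  assumes V: "\<And>x y. x \<in> V \<Longrightarrow> y \<in> V \<Longrightarrow> x - y \<in> V" "\<And>c x. x \<in> V \<Longrightarrow> c *s x \<in> V"
      "\<And>x. x \<in> V \<Longrightarrow> A *v x \<in> V"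
    and "v \<in> V" "v \<noteq> 0" "\<exists>i\<le>n. c i \<noteq> 0" "(\<Sum>i\<le>n. c i *s (mpow A i *v v)) = 0"
  shows "\<exists>w\<in>V. \<exists>l. w \<noteq> 0 \<and> A *v w = l *s w"
  using assms(4-)
proof (induction n arbitrary: v c)
  case 0
  then show ?case by simp
next
  case (Suc m)
  show ?case
  proof (cases "c (Suc m) = 0")
    case True
    with Suc.prems have "\<exists>i\<le>m. c i \<noteq> 0" "(\<Sum>i\<le>m. c i *s (mpow A i *v v)) = 0"
      by (auto simp: le_Suc_eq)
    then show ?thesis using Suc.IH Suc.prems(1,2) by blast
  next
    case False
    then have "c 0 = 0 \<or> (\<exists>i\<in>{1..Suc m}. c i \<noteq> 0)" by auto
    then obtain l where l: "(\<Sum>i\<le>Suc m. c i * l ^ i) = 0"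
      by (rule fundamental_theorem_of_algebra)
    \<comment> \<open>the coefficients of the quotient by the factor \<open>X - l\<close>\<close>
    define b where "b i = (\<Sum>k=Suc i..Suc m. c k * l ^ (k - Suc i))" for i
    have b_Suc: "c (Suc i) = b i - l * b (Suc i)" if "i \<le> m" for i
    proof -
      have "b i = c (Suc i) + (\<Sum>k=Suc (Suc i)..Suc m. c k * l ^ (k - Suc i))"
        using that unfolding b_def by (subst sum.atLeast_Suc_atMost) auto
      also have "(\<Sum>k=Suc (Suc i)..Suc m. c k * l ^ (k - Suc i)) = l * b (Suc i)"
        unfolding b_def sum_distrib_left
      proof (intro sum.cong refl)
        fix k assume "k \<in> {Suc (Suc i)..Suc m}"
        then have "k - Suc i = Suc (k - Suc (Suc i))" by auto
        then show "c k * l ^ (k - Suc i) = l * (c k * l ^ (k - Suc (Suc i)))" by simp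
      qed
      finally show ?thesis by simp
    qed
    have b_0: "c 0 = - l * b 0"
    proof -
      have "(\<Sum>i\<le>Suc m. c i * l ^ i) = c 0 + (\<Sum>k=Suc 0..Suc m. c k * l ^ k)"
        unfolding atMost_atLeast0 by (subst sum.atLeast_Suc_atMost) auto
      also have "(\<Sum>k=Suc 0..Suc m. c k * l ^ k) = l * b 0"
        unfolding b_def sum_distrib_left
      proof (intro sum.cong refl)
        fix k assume "k \<in> {Suc 0..Suc m}"
        then have "k = Suc (k - Suc 0)" by auto
        then have "l ^ k = l * l ^ (k - Suc 0)" by (metis power_Suc)
        then show "c k * l ^ k = l * (c k * l ^ (k - Suc 0))" by simp
      qed
      finally show ?thesis using l by (simp add: add_eq_0_iff)
    qed
    have b_top: "b (Suc m) = 0" "b m = c (Suc m)"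
      by (simp_all add: b_def)
    define w where "w = A *v v - l *s v"
    define u where "u i = mpow A i *v v" for i
    have pow_w: "mpow A i *v w = u (Suc i) - l *s u i" for i
    proof -
      have "mpow A i *v (A *v v) = u (Suc i)"
        using mpow_commute[of A A i] by (simp add: u_def matrix_vector_mul_assoc)
      then show ?thesis
        by (simp add: w_def u_def matrix_vector_mult_diff_distrib vector_scalar_commute)
    qed
    have "(\<Sum>i\<le>m. b i *s (mpow A i *v w)) = (\<Sum>i\<le>m. b i *s u (Suc i)) - l *s (\<Sum>i\<le>m. b i *s u i)"
      unfolding pow_w
      by (simp add: vec_eq_iff sum_subtractf sum_distrib_left algebra_simps)
    also have "(\<Sum>i\<le>m. b i *s u i) = (\<Sum>i\<le>Suc m. b i *s u i)"
      by (simp add: b_top)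
    also have "\<dots> = b 0 *s u 0 + (\<Sum>i\<le>m. b (Suc i) *s u (Suc i))"
      by (rule sum.atMost_Suc_shift)
    also have "(\<Sum>i\<le>m. b i *s u (Suc i)) - l *s (b 0 *s u 0 + (\<Sum>i\<le>m. b (Suc i) *s u (Suc i)))
        = c 0 *s u 0 + (\<Sum>i\<le>m. (b i - l * b (Suc i)) *s u (Suc i))"
      by (simp add: b_0 vec_eq_iff sum_subtractf sum_distrib_left algebra_simps)
    also have "(\<Sum>i\<le>m. (b i - l * b (Suc i)) *s u (Suc i)) = (\<Sum>i\<le>m. c (Suc i) *s u (Suc i))"
      by (intro sum.cong refl) (simp add: b_Suc)
    also have "c 0 *s u 0 + \<dots> = (\<Sum>i\<le>Suc m. c i *s u i)"
      by (rule sum.atMost_Suc_shift[symmetric])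
    finally have rel: "(\<Sum>i\<le>m. b i *s (mpow A i *v w)) = 0"
      using Suc.prems(4) by (simp add: u_def)
    show ?thesis
    proof (cases "w = 0")
      case True
      then show ?thesis using Suc.prems(1,2) by (auto simp: w_def)
    next
      case w: False
      have "w \<in> V" using Suc.prems(1) V by (simp add: w_def)
      moreover have "\<exists>i\<le>m. b i \<noteq> 0" using b_top(2) False by auto
      ultimately show ?thesis using Suc.IH w rel by blast
    qed
  qed
qed

text \<open>
  A joint eigenspace of the first \<open>k\<close> matrices inside \<open>V\<close> is invariant under
  the next matrix because the tuple commutes, so it contains an eigenvector of that matrix.
\<close>

lemma joint_eigenvector:
  fixes T :: "nat \<Rightarrow> complex^'n^'n"
  assumes comm: "commuting_tuple d T"
    and V: "\<And>x y. x \<in> V \<Longrightarrow> y \<in> V \<Longrightarrow> x - y \<in> V" "\<And>c x. x \<in> V \<Longrightarrow> c *s x \<in> V"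
      "\<And>j x. j < d \<Longrightarrow> x \<in> V \<Longrightarrow> T j *v x \<in> V"
    and v: "v \<in> V" "v \<noteq> 0"
  obtains w l where "w \<in> V" "norm w = 1" "\<And>j. j < d \<Longrightarrow> T j *v w = l j *s w"
proof -
  have "\<exists>w\<in>V. \<exists>l. w \<noteq> 0 \<and> (\<forall>j<k. T j *v w = l j *s w)" if "k \<le> d" for k
    using that
  proof (induction k)
    case 0
    then show ?case using v by auto
  next
    case (Suc k)
    then obtain w l where w: "w \<in> V" "w \<noteq> 0" "\<And>j. j < k \<Longrightarrow> T j *v w = l j *s w"
      by auto
    define W where "W = {x \<in> V. \<forall>j<k. T j *v x = l j *s x}"
    have TW: "T k *v x \<in> W" if "x \<in> W" for x
    proof -
      have "T j *v (T k *v x) = l j *s (T k *v x)" if "j < k" for j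
      proof -
        have "T j *v (T k *v x) = T k *v (T j *v x)"
          using commuting_tupleD[OF comm, of j k] Suc.prems that by (simp add: matrix_vector_mul_assoc)
        also have "\<dots> = T k *v (l j *s x)"
          using \<open>x \<in> W\<close> that by (simp add: W_def)
        finally show ?thesis by (simp add: vector_scalar_commute)
      qed
      then show ?thesis
        using \<open>x \<in> W\<close> V(3)[of k x] Suc.prems by (simp add: W_def)
    qed
    obtain c where c: "\<exists>i\<le>CARD('n). c i \<noteq> 0" "(\<Sum>i\<le>CARD('n). c i *s (mpow (T k) i *v w)) = 0"
      by (rule exists_linear_relation)
    have "\<exists>x\<in>W. \<exists>m. x \<noteq> 0 \<and> T k *v x = m *s x"
    proof (rule eigenvector_of_annihilator[where v = w and n = "CARD('n)" and c = c])
      show "x - y \<in> W" if "x \<in> W" "y \<in> W" for x y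
        using that V(1) by (simp add: W_def matrix_vector_mult_diff_distrib vector_ssub_ldistrib)
      show "a *s x \<in> W" if "x \<in> W" for a x
        using that V(2) by (simp add: W_def vector_scalar_commute vector_smult_assoc mult.commute)
    qed (use w c TW in \<open>auto simp: W_def\<close>)
    then obtain x m where x: "x \<in> W" "x \<noteq> 0" "T k *v x = m *s x" by blast
    then have "\<forall>j<Suc k. T j *v x = (l(k := m)) j *s x"
      by (auto simp: W_def less_Suc_eq)
    then have "\<exists>l. \<forall>j<Suc k. T j *v x = l j *s x"
      by (intro exI[of _ "l(k := m)"])
    then show ?case using x(1,2) unfolding W_def by blast
  qed
  from this[of d] obtain w l where w: "w \<in> V" "w \<noteq> 0" "\<And>j. j < d \<Longrightarrow> T j *v w = l j *s w"
    by auto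
  define w' where "w' = of_real (inverse (norm w)) *s w"
  have "T j *v w' = l j *s w'" if "j < d" for j
    using w(3)[OF that] by (simp add: w'_def vector_scalar_commute vector_smult_assoc mult.commute)
  moreover have "norm w' = 1"
    using w(2) by (simp add: w'_def norm_scale norm_inverse)
  ultimately show ?thesis
    using that[of w' l] w(1) V(2) by (auto simp: w'_def)
qed

text \<open>
  The conjugate of the cross product; its length comes from the Lagrange identity.
\<close>

lemma exists_orthogonal_unit:
  fixes e f :: "complex^3"
  assumes "norm e = 1" "norm f = 1" "hdot e f = 0"
  obtains g where "norm g = 1" "hdot e g = 0" "hdot f g = 0"
proof -
  define g :: "complex^3" where "g = vector [cnj (e$2 * f$3 - e$3 * f$2), cnj (e$3 * f$1 - e$1 * f$3), cnj (e$1 * f$2 - e$2 * f$1)]"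
  have "hdot g g = hdot e e * hdot f f - hdot e f * hdot f e"
    by (simp add: hdot_def sum_3 g_def algebra_simps)
  also have "\<dots> = 1"
    using assms by (simp add: hdot_self)
  finally have "complex_of_real ((norm g)\<^sup>2) = of_real (1\<^sup>2)"
    unfolding hdot_self by simp
  then have "(norm g)\<^sup>2 = 1\<^sup>2"
    by (simp only: of_real_eq_iff)
  then have "norm g = 1"
    by (rule power2_eq_imp_eq) simp_all
  moreover have "hdot e g = 0" "hdot f g = 0"
    by (simp_all add: hdot_def sum_3 g_def algebra_simps)
  ultimately show ?thesis by (rule that)
qed

text \<open>
  Take a joint eigenvector \<open>e1\<close> of the tuple, and a joint eigenvector \<open>e3\<close>
  of the adjoint tuple in the orthogonal complement of \<open>e1\<close>, which is invariant under
  the adjoints. In an orthonormal basis \<open>e1, e2, e3\<close> the first column and the last row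
  of every matrix have the required zeros.
\<close>

lemma unitary_triangularization:
  fixes T :: "nat \<Rightarrow> complex^3^3"
  assumes comm: "commuting_tuple d T"
  obtains U :: "complex^3^3" where "ctranspose U ** U = mat 1" "U ** ctranspose U = mat 1"
    "\<And>j. j < d \<Longrightarrow> (ctranspose U ** T j ** U) $ 2 $ 1 = 0"
    "\<And>j. j < d \<Longrightarrow> (ctranspose U ** T j ** U) $ 3 $ 1 = 0"
    "\<And>j. j < d \<Longrightarrow> (ctranspose U ** T j ** U) $ 3 $ 2 = 0"
proof -
  have "axis 1 1 \<noteq> (0 :: complex^3)" by (simp add: axis_eq_0_iff)
  then obtain e1 l1 where e1: "norm e1 = 1" "\<And>j. j < d \<Longrightarrow> T j *v e1 = l1 j *s e1"
    using joint_eigenvector[OF comm, of UNIV "axis 1 1"] by auto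
  define v :: "complex^3" where
    "v = (if e1 $ 1 = 0 \<and> e1 $ 2 = 0 then axis 1 1 else vector [- cnj (e1 $ 2), cnj (e1 $ 1), 0])"
  have v: "hdot e1 v = 0" "v \<noteq> 0"
    by (auto simp: v_def hdot_def sum_3 vec_eq_iff forall_3 axis_def)
  have comm': "commuting_tuple d (\<lambda>j. ctranspose (T j))"
    using comm by (simp add: commuting_tuple_def flip: ctranspose_mult)
  obtain e3 l3 where e3: "hdot e1 e3 = 0" "norm e3 = 1" "\<And>j. j < d \<Longrightarrow> ctranspose (T j) *v e3 = l3 j *s e3"
  proof (rule joint_eigenvector[OF comm', of "{x. hdot e1 x = 0}" v])
    show "ctranspose (T j) *v x \<in> {x. hdot e1 x = 0}" if "j < d" "x \<in> {x. hdot e1 x = 0}" for j x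
      using that by (simp add: hdot_ctranspose' e1(2) hdot_scale)
  qed (use v in \<open>auto simp: hdot_diff hdot_scale\<close>)
  obtain e2 where e2: "norm e2 = 1" "hdot e1 e2 = 0" "hdot e3 e2 = 0"
    using exists_orthogonal_unit[OF e1(1) e3(2,1)] .
  define U :: "complex^3^3" where "U = (\<chi> i. vector [e1 $ i, e2 $ i, e3 $ i])"
  have U: "U $ i $ 1 = e1 $ i" "U $ i $ 2 = e2 $ i" "U $ i $ 3 = e3 $ i" for i
    by (simp_all add: U_def)
  have sym: "hdot x y = 0" if "hdot y x = 0" for x y :: "complex^3"
    using cnj_hdot[of y x] that by simp
  have entry: "(ctranspose U ** U) $ k $ l = hdot (column k U) (column l U)" for k l
    by (simp add: matrix_matrix_mult_def hdot_def column_def)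
  have cols: "column 1 U = e1" "column 2 U = e2" "column 3 U = e3"
    by (simp_all add: column_def vec_eq_iff U)
  have "ctranspose U ** U = mat 1"
    by (simp add: vec_eq_iff forall_3 entry cols hdot_self e1 e2 e3 sym mat_def)
  moreover from this have "U ** ctranspose U = mat 1"
    using matrix_left_right_inverse by blast
  moreover have conj: "(ctranspose U ** A ** U) $ k $ l = hdot (column k U) (A *v column l U)" for A k l
  proof -
    have "(ctranspose U ** A ** U) $ k $ l = (ctranspose U ** (A ** U)) $ k $ l"
      by (simp only: matrix_mul_assoc)
    then show ?thesis
      by (simp add: matrix_matrix_mult_def matrix_vector_mult_def hdot_def column_def)
  qed
  moreover have "hdot e3 (T j *v x) = cnj (l3 j) * hdot e3 x" if "j < d" for j x
    using e3(3)[OF that] by (simp add: hdot_ctranspose[symmetric] hdot_scale)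
  ultimately show ?thesis
    using that[of U] e1(2) e2 e3(1) sym by (simp add: cols hdot_scale)
qed

section \<open>Reduction to two variables\<close>

lemma sum_lessThan_2: "(\<Sum>j<2. f j) = f 0 + f (1::nat)"
  by (simp add: numeral_2_eq_2)

lemma parallel_common_direction:
  fixes f g h :: "nat \<Rightarrow> complex"
  assumes "\<And>j k. j < d \<Longrightarrow> k < d \<Longrightarrow> f j * g k = f k * g j"
    and "\<And>j k. j < d \<Longrightarrow> k < d \<Longrightarrow> f j * h k = f k * h j"
    and "\<And>j k. j < d \<Longrightarrow> k < d \<Longrightarrow> g j * h k = g k * h j"
  shows "\<exists>q x y z. \<forall>j<d. f j = x * q j \<and> g j = y * q j \<and> h j = z * q j"
proof -
  consider m where "m < d" "f m \<noteq> 0" | m where "\<And>j. j < d \<Longrightarrow> f j = 0" "m < d" "g m \<noteq> 0"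
    | "\<And>j. j < d \<Longrightarrow> f j = 0 \<and> g j = 0"
    by blast
  then show ?thesis
  proof cases
    case 1
    show ?thesis
      by (rule exI[of _ f], rule exI[of _ 1], rule exI[of _ "g m / f m"], rule exI[of _ "h m / f m"]) (use 1 assms(1,2)[of m] in \<open>auto simp: field_simps\<close>)
  next
    case 2
    show ?thesis
      by (rule exI[of _ g], rule exI[of _ 0], rule exI[of _ 1], rule exI[of _ "h m / g m"]) (use 2 assms(3)[of m] in \<open>auto simp: field_simps\<close>)
  next
    case 3
    show ?thesis
      by (rule exI[of _ h], rule exI[of _ 0], rule exI[of _ 0], rule exI[of _ 1]) (use 3 in auto)
  qed
qed

lemma triangular_commutation:
  fixes A B :: "complex^3^3"
  assumes "A ** B = B ** A"
    and "A $ 2 $ 1 = 0" "A $ 3 $ 1 = 0" "A $ 3 $ 2 = 0" "A $ 2 $ 2 = 0"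
    and "B $ 2 $ 1 = 0" "B $ 3 $ 1 = 0" "B $ 3 $ 2 = 0" "B $ 2 $ 2 = 0"
  shows "A $ 1 $ 1 * B $ 1 $ 2 = B $ 1 $ 1 * A $ 1 $ 2"
    and "A $ 2 $ 3 * B $ 3 $ 3 = B $ 2 $ 3 * A $ 3 $ 3"
    and "A $ 1 $ 1 * B $ 1 $ 3 + A $ 1 $ 2 * B $ 2 $ 3 + A $ 1 $ 3 * B $ 3 $ 3
      = B $ 1 $ 1 * A $ 1 $ 3 + B $ 1 $ 2 * A $ 2 $ 3 + B $ 1 $ 3 * A $ 3 $ 3"
proof -
  have "(A ** B) $ i $ k = (B ** A) $ i $ k" for i k
    using assms(1) by simp
  from this[of 1 2] this[of 2 3] this[of 1 3]
  show "A $ 1 $ 1 * B $ 1 $ 2 = B $ 1 $ 1 * A $ 1 $ 2"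
    and "A $ 2 $ 3 * B $ 3 $ 3 = B $ 2 $ 3 * A $ 3 $ 3"
    and "A $ 1 $ 1 * B $ 1 $ 3 + A $ 1 $ 2 * B $ 2 $ 3 + A $ 1 $ 3 * B $ 3 $ 3
      = B $ 1 $ 1 * A $ 1 $ 3 + B $ 1 $ 2 * A $ 2 $ 3 + B $ 1 $ 3 * A $ 3 $ 3"
    using assms(2-) by (simp_all add: matrix_matrix_mult_def sum_3)
qed

text \<open>
  Regard the five possibly nonzero entries as vectors indexed by \<open>j\<close>. Comparing the
  entries \<open>(2, 3)\<close> of the products shows that the vectors \<open>b\<close> and
  \<open>n\<close> are multiples of one vector \<open>p\<close>. If \<open>p\<close> is nonzero, the
  remaining relations show that \<open>l\<close>, \<open>a\<close> and \<open>c\<close> are parallel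
  modulo \<open>p\<close>. If \<open>b\<close> and \<open>n\<close> vanish, then \<open>a\<close>
  and \<open>c\<close> are multiples of \<open>l\<close>, or \<open>l\<close> vanishes and
  \<open>a\<close> and \<open>c\<close> span.
\<close>

lemma two_dimensional_span:
  fixes S :: "nat \<Rightarrow> complex^3^3"
  assumes comm: "commuting_tuple d S"
    and tri: "\<And>j. j < d \<Longrightarrow> S j $ 2 $ 1 = 0" "\<And>j. j < d \<Longrightarrow> S j $ 3 $ 1 = 0"
      "\<And>j. j < d \<Longrightarrow> S j $ 3 $ 2 = 0" "\<And>j. j < d \<Longrightarrow> S j $ 2 $ 2 = 0"
  obtains p q and X Y :: "complex^3^3" where
    "\<And>j. j < d \<Longrightarrow> S j = mat (p j) ** X + mat (q j) ** Y"
    "X $ 2 $ 1 = 0" "X $ 3 $ 1 = 0" "\<And>k. Y $ 2 $ k = 0" "\<And>k. Y $ 3 $ k = 0"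
proof -
  define l a c b n where "l j = S j $ 1 $ 1" and "a j = S j $ 1 $ 2" and "c j = S j $ 1 $ 3"
    and "b j = S j $ 2 $ 3" and "n j = S j $ 3 $ 3" for j
  define tri_mat :: "complex \<Rightarrow> complex \<Rightarrow> complex \<Rightarrow> complex \<Rightarrow> complex \<Rightarrow> complex^3^3" where
    "tri_mat l a c b n = vector [vector [l, a, c], vector [0, 0, b], vector [0, 0, n]]" for l a c b n
  note entries = l_def a_def c_def b_def n_def
  note result = that
  have decomp: thesis
    if l: "\<And>j. j < d \<Longrightarrow> l j = x1 * p j + y1 * q j" and a: "\<And>j. j < d \<Longrightarrow> a j = x2 * p j + y2 * q j"
      and c: "\<And>j. j < d \<Longrightarrow> c j = x3 * p j + y3 * q j" and b: "\<And>j. j < d \<Longrightarrow> b j = x4 * p j"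
      and n: "\<And>j. j < d \<Longrightarrow> n j = x5 * p j"
    for p q x1 x2 x3 x4 x5 y1 y2 y3
  proof (rule result)
    show "S j = mat (p j) ** tri_mat x1 x2 x3 x4 x5 + mat (q j) ** tri_mat y1 y2 y3 0 0" if "j < d" for j
      using tri[OF that] l[OF that] a[OF that] c[OF that] b[OF that] n[OF that]
      by (simp add: vec_eq_iff forall_3 mat_matrix_mult_nth tri_mat_def entries mult.commute)
    have zero: "vector [0, 0, 0] $ k = (0 :: complex)" for k :: 3
      using exhaust_3[of k] by auto
    show "tri_mat y1 y2 y3 0 0 $ 2 $ k = 0" "tri_mat y1 y2 y3 0 0 $ 3 $ k = 0" for k
      by (simp_all add: tri_mat_def zero)
  qed (simp_all add: tri_mat_def)
  have rel: "l j * a k = l k * a j" "b j * n k = b k * n j"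
      "l j * c k + a j * b k + c j * n k = l k * c j + a k * b j + c k * n j" if "j < d" "k < d" for j k
    using triangular_commutation[OF commuting_tupleD[OF comm that]] tri that
    unfolding entries by blast+
  show thesis
  proof (cases "\<exists>i<d. b i \<noteq> 0 \<or> n i \<noteq> 0")
    case True
    then obtain i where i: "i < d" "b i \<noteq> 0 \<or> n i \<noteq> 0" by blast
    \<comment> \<open>normalized to have the value \<open>1\<close> at the pivot \<open>i\<close>, so that subtracting a multiple of \<open>p\<close> removes this entry\<close>
    define p where "p j = (if b i \<noteq> 0 then b j / b i else n j / n i)" for j
    have p1: "p i = 1" using i by (auto simp: p_def)
    have bn: "b j = b i * p j" "n j = n i * p j" if "j < d" for j
      using rel(2)[OF that i(1)] i(2) by (auto simp: p_def field_simps)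
    define f g h where "f j = l j - l i * p j" and "g j = a j - a i * p j" and "h j = c j - c i * p j" for j
    have fg: "f j * g k = f k * g j" if "j < d" "k < d" for j k
      using rel(1)[OF that] rel(1)[OF that(1) i(1)] rel(1)[OF that(2) i(1)]
      unfolding f_def g_def by algebra
    have rel3: "l j * c k + (a j * b i * p k) + c j * n i * p k = l k * c j + a k * b i * p j + c k * n i * p j"
      if "j < d" "k < d" for j k
      using rel(3)[OF that] bn(1)[OF that(1)] bn(1)[OF that(2)] bn(2)[OF that(1)] bn(2)[OF that(2)]
      by (simp add: mult.assoc)
    have fh: "f j * h k = f k * h j" if "j < d" "k < d" for j k
      using rel3[OF that] rel3[OF that(1) i(1)] rel3[OF that(2) i(1)]
      unfolding f_def h_def p1 by algebra
    have ch: "(l i - n i) * h k = b i * g k + f k * c i" if "k < d" for k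
      using rel3[OF i(1) that] unfolding f_def g_def h_def p1 by algebra
    have lg: "l i * g k = f k * a i" if "k < d" for k
      using rel(1)[OF i(1) that] unfolding f_def g_def by algebra
    have gh: "g j * h k = g k * h j" if "j < d" "k < d" for j k
    proof (cases "f j = 0 \<and> f k = 0")
      case True
      then have eq: "(l i - n i) * h j = b i * g j" "(l i - n i) * h k = b i * g k" "l i * g j = 0" "l i * g k = 0"
        using ch lg that by auto
      show ?thesis
      proof (cases "l i = 0")
        case True
        then have "n i * h j = - (b i * g j)" "n i * h k = - (b i * g k)"
          using eq(1,2) by algebra+
        then have "b i * (g j * h k - g k * h j) = 0" "n i * (g j * h k - g k * h j) = 0"
          by algebra+
        then show ?thesis using i(2) by auto
      next
        case False
        then show ?thesis using eq by auto
      qed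
    next
      case False
      have "f j * (g j * h k - g k * h j) = 0" "f k * (g j * h k - g k * h j) = 0"
        using fg[OF that] fh[OF that] by algebra+
      then show ?thesis using False by auto
    qed
    have "\<exists>q x y z. \<forall>j<d. f j = x * q j \<and> g j = y * q j \<and> h j = z * q j"
      by (rule parallel_common_direction) (fact fg fh gh)+
    then obtain q x y z where q: "\<forall>j<d. f j = x * q j \<and> g j = y * q j \<and> h j = z * q j"
      by blast
    show thesis
      by (rule decomp[of "l i" p x q "a i" y "c i" z "b i" "n i"])
        (use q bn in \<open>auto simp: f_def g_def h_def diff_eq_eq add.commute\<close>)
  next
    case False
    then have bn: "b j = 0" "n j = 0" if "j < d" for j
      using that by auto
    show thesis
    proof (cases "\<exists>m<d. l m \<noteq> 0")
      case True
      then obtain m where m: "m < d" "l m \<noteq> 0" by blast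
      have "a j = (a m / l m) * l j" "c j = (c m / l m) * l j" if "j < d" for j
        using rel(1)[OF that m(1)] rel(3)[OF that m(1)] bn[OF that] bn[OF m(1)] m(2)
        by (simp_all add: field_simps)
      then show thesis
        by (intro decomp[of 0 "\<lambda>_. 0" 1 l 0 "a m / l m" 0 "c m / l m" 0 0]) (use bn in auto)
    next
      case False
      then show thesis
        by (intro decomp[of 0 a 0 c 1 0 0 1 0 0]) (use bn in auto)
    qed
  qed
qed

text \<open>
  Gram--Schmidt for two vectors. In degenerate cases the value \<open>0\<close> is accepted in place
  of a unit vector, provided that its coefficients vanish, so that the dimension \<open>d\<close>
  can be arbitrary.
\<close>

lemma orthonormal_pair:
  fixes p q :: "nat \<Rightarrow> complex"
  obtains w0 w1 \<alpha> \<beta> \<gamma> where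
    "\<And>j. j < d \<Longrightarrow> p j = \<alpha> * w0 j" "\<And>j. j < d \<Longrightarrow> q j = \<beta> * w0 j + \<gamma> * w1 j"
    "(\<Sum>j<d. cnj (w0 j) * w1 j) = 0"
    "(\<Sum>j<d. (cmod (w0 j))\<^sup>2) = 1 \<or> (\<alpha> = 0 \<and> \<beta> = 0 \<and> (\<Sum>j<d. (cmod (w0 j))\<^sup>2) = 0)"
    "(\<Sum>j<d. (cmod (w1 j))\<^sup>2) = 1 \<or> (\<gamma> = 0 \<and> (\<Sum>j<d. (cmod (w1 j))\<^sup>2) = 0)"
proof -
  have normalize: "\<exists>w \<alpha>. (\<forall>j<d. v j = \<alpha> * w j) \<and> (\<forall>j. w j = inverse \<alpha> * v j) \<and>
      ((\<Sum>j<d. (cmod (w j))\<^sup>2) = 1 \<or> (\<alpha> = 0 \<and> (\<Sum>j<d. (cmod (w j))\<^sup>2) = 0))" for v :: "nat \<Rightarrow> complex"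
  proof -
    define r where "r = sqrt (\<Sum>j<d. (cmod (v j))\<^sup>2)"
    define w where "w j = inverse (of_real r) * v j" for j
    have r2: "r\<^sup>2 = (\<Sum>j<d. (cmod (v j))\<^sup>2)" by (simp add: r_def sum_nonneg)
    have n: "(\<Sum>j<d. (cmod (w j))\<^sup>2) = (inverse r)\<^sup>2 * r\<^sup>2"
      by (simp add: w_def norm_mult norm_inverse power_mult_distrib r2 sum_distrib_left power_inverse)
    have "\<forall>j<d. v j = of_real r * w j"
    proof (cases "r = 0")
      case True
      then have "\<forall>j<d. v j = 0"
        using r2 by (simp add: sum_nonneg_eq_0_iff)
      then show ?thesis by (simp add: w_def)
    qed (simp add: w_def)
    then show ?thesis
      using n by (intro exI[of _ w] exI[of _ "of_real r"]) (auto simp: w_def field_simps)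
  qed
  from normalize[of p] obtain w0 \<alpha> where w0: "\<forall>j<d. p j = \<alpha> * w0 j" "\<forall>j. w0 j = inverse \<alpha> * p j"
    "(\<Sum>j<d. (cmod (w0 j))\<^sup>2) = 1 \<or> (\<alpha> = 0 \<and> (\<Sum>j<d. (cmod (w0 j))\<^sup>2) = 0)"
    by blast
  define \<beta> where "\<beta> = (\<Sum>j<d. cnj (w0 j) * q j)"
  from normalize[of "\<lambda>j. q j - \<beta> * w0 j"] obtain w1 \<gamma> where w1:
    "\<forall>j<d. q j - \<beta> * w0 j = \<gamma> * w1 j" "\<forall>j. w1 j = inverse \<gamma> * (q j - \<beta> * w0 j)"
    "(\<Sum>j<d. (cmod (w1 j))\<^sup>2) = 1 \<or> (\<gamma> = 0 \<and> (\<Sum>j<d. (cmod (w1 j))\<^sup>2) = 0)"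
    by blast
  have n0: "(\<Sum>j<d. cnj (w0 j) * w0 j) = of_real (\<Sum>j<d. (cmod (w0 j))\<^sup>2)"
    by (simp add: mult.commute complex_norm_square del: of_real_power)
  have \<beta>0: "\<beta> = 0" if "(\<Sum>j<d. (cmod (w0 j))\<^sup>2) = 0"
  proof -
    have "\<forall>j<d. w0 j = 0" using that by (simp add: sum_nonneg_eq_0_iff)
    then show ?thesis by (simp add: \<beta>_def)
  qed
  have "(\<Sum>j<d. cnj (w0 j) * w1 j) = inverse \<gamma> * (\<beta> - \<beta> * (\<Sum>j<d. cnj (w0 j) * w0 j))"
    unfolding w1(2)[rule_format] by (simp add: \<beta>_def sum_distrib_left sum_subtractf algebra_simps)
  also have "\<dots> = 0"
    using w0(3)
  proof
    assume "(\<Sum>j<d. (cmod (w0 j))\<^sup>2) = 1"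
    then show ?thesis unfolding n0 by simp
  qed (simp add: \<beta>0)
  finally have orth: "(\<Sum>j<d. cnj (w0 j) * w1 j) = 0" .
  show ?thesis
  proof (rule that[of \<alpha> w0 \<beta> \<gamma> w1])
    show "q j = \<beta> * w0 j + \<gamma> * w1 j" if "j < d" for j
      using w1(1)[rule_format, OF that] by (simp add: diff_eq_eq add.commute)
    show "(\<Sum>j<d. (cmod (w0 j))\<^sup>2) = 1 \<or> (\<alpha> = 0 \<and> \<beta> = 0 \<and> (\<Sum>j<d. (cmod (w0 j))\<^sup>2) = 0)"
      using w0(3) \<beta>0 by blast
  qed (use w0(1) in blast, fact orth, fact w1(3))
qed

lemma norm_add_square: "(norm (x + y))\<^sup>2 = (norm x)\<^sup>2 + 2 * Re (hdot x y) + (norm y)\<^sup>2"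
  by (simp add: power2_norm_eq_inner Re_hdot inner_add inner_commute)

lemma orthogonal_combination_norm:
  fixes u v :: "complex^'n"
  assumes "(\<Sum>j<d. cnj (w0 j) * w1 j) = 0"
  shows "(\<Sum>j<d. (norm (w0 j *s u + w1 j *s v))\<^sup>2)
    = (\<Sum>j<d. (cmod (w0 j))\<^sup>2) * (norm u)\<^sup>2 + (\<Sum>j<d. (cmod (w1 j))\<^sup>2) * (norm v)\<^sup>2"
proof -
  have "(norm (w0 j *s u + w1 j *s v))\<^sup>2
      = (cmod (w0 j))\<^sup>2 * (norm u)\<^sup>2 + (cmod (w1 j))\<^sup>2 * (norm v)\<^sup>2 + 2 * Re (cnj (w0 j) * w1 j * hdot u v)" for j
    by (simp add: norm_add_square norm_scale power_mult_distrib hdot_scale algebra_simps)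
  then have "(\<Sum>j<d. (norm (w0 j *s u + w1 j *s v))\<^sup>2)
      = (\<Sum>j<d. (cmod (w0 j))\<^sup>2) * (norm u)\<^sup>2 + (\<Sum>j<d. (cmod (w1 j))\<^sup>2) * (norm v)\<^sup>2
        + 2 * Re ((\<Sum>j<d. cnj (w0 j) * w1 j) * hdot u v)"
    by (simp only: sum.distrib sum_distrib_right[symmetric] sum_distrib_left[symmetric] Re_sum[symmetric])
  then show ?thesis by (simp add: assms)
qed

text \<open>
  For an orthonormal pair \<open>w0, w1\<close> spanning the coefficient vectors of the tuple, the map
  \<open>z \<mapsto> z\<^sub>0 w0 + z\<^sub>1 w1\<close> takes the ball into the ball, and the tuple
  is the image of \<open>(R 0, R 1)\<close> under it. In the direction of a unit vector the map is
  isometric, and a vanishing \<open>w0\<close> or \<open>w1\<close> goes with a vanishing matrix; so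
  the pair inherits row contractivity.
\<close>

lemma compression_to_pair:
  fixes S :: "nat \<Rightarrow> complex^3^3"
  assumes comm: "commuting_tuple d S" and contr: "row_contractive d S" and "0 \<le> C"
    and tri: "\<And>j. j < d \<Longrightarrow> S j $ 2 $ 1 = 0" "\<And>j. j < d \<Longrightarrow> S j $ 3 $ 1 = 0"
      "\<And>j. j < d \<Longrightarrow> S j $ 3 $ 2 = 0" "\<And>j. j < d \<Longrightarrow> S j $ 2 $ 2 = 0"
  obtains R :: "nat \<Rightarrow> complex^3^3" where "commuting_tuple 2 R" "row_contractive 2 R"
    "R 0 $ 2 $ 1 = 0" "R 0 $ 3 $ 1 = 0" "\<And>k. R 1 $ 2 $ k = 0" "\<And>k. R 1 $ 3 $ k = 0"
    "satisfies_vN 2 R C \<Longrightarrow> satisfies_vN d S C"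
proof -
  obtain p X q Y where pq: "\<And>j. j < d \<Longrightarrow> S j = mat (p j) ** X + mat (q j) ** Y"
    "X $ 2 $ 1 = 0" "X $ 3 $ 1 = 0" "\<And>k. Y $ 2 $ k = 0" "\<And>k. Y $ 3 $ k = 0"
    by (rule two_dimensional_span[OF comm tri]) (assumption, assumption, assumption, assumption, rule that)
  obtain w0 w1 \<alpha> \<beta> \<gamma> where w:
    "\<And>j. j < d \<Longrightarrow> p j = \<alpha> * w0 j" "\<And>j. j < d \<Longrightarrow> q j = \<beta> * w0 j + \<gamma> * w1 j"
    "(\<Sum>j<d. cnj (w0 j) * w1 j) = 0"
    "(\<Sum>j<d. (cmod (w0 j))\<^sup>2) = 1 \<or> (\<alpha> = 0 \<and> \<beta> = 0 \<and> (\<Sum>j<d. (cmod (w0 j))\<^sup>2) = 0)"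
    "(\<Sum>j<d. (cmod (w1 j))\<^sup>2) = 1 \<or> (\<gamma> = 0 \<and> (\<Sum>j<d. (cmod (w1 j))\<^sup>2) = 0)"
    by (rule orthonormal_pair[of d p q]) (rule that)
  define R0 R1 where "R0 = mat \<alpha> ** X + mat \<beta> ** Y" and "R1 = mat \<gamma> ** Y"
  define R where "R j = (if j = (0::nat) then R0 else R1)" for j
  have S: "S j = mat (w0 j) ** R0 + mat (w1 j) ** R1" if "j < d" for j
    unfolding pq(1)[OF that] w(1,2)[OF that] R0_def R1_def
    by (simp add: vec_eq_iff mat_matrix_mult_nth algebra_simps)
  define n0 n1 where "n0 = (\<Sum>j<d. (cmod (w0 j))\<^sup>2)" and "n1 = (\<Sum>j<d. (cmod (w1 j))\<^sup>2)"
  have n: "n0 = 1 \<or> (R0 = 0 \<and> n0 = 0)" "n1 = 1 \<or> (R1 = 0 \<and> n1 = 0)"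
    using w(4,5) by (auto simp: R0_def R1_def n0_def n1_def)
  have w10: "(\<Sum>j<d. cnj (w1 j) * w0 j) = 0"
  proof -
    have "(\<Sum>j<d. cnj (w1 j) * w0 j) = cnj (\<Sum>j<d. cnj (w0 j) * w1 j)"
      by (simp add: mult.commute)
    then show ?thesis by (simp add: w(3))
  qed
  have sq: "(\<Sum>j<d. cnj (w0 j) * w0 j) = of_real n0" "(\<Sum>j<d. cnj (w1 j) * w1 j) = of_real n1"
    by (simp_all add: n0_def n1_def mult.commute complex_norm_square del: of_real_power)
  have comb: "(\<Sum>j<d. mat (cnj (v j)) ** S j)
      = mat (\<Sum>j<d. cnj (v j) * w0 j) ** R0 + mat (\<Sum>j<d. cnj (v j) * w1 j) ** R1" for v
    by (simp add: S vec_eq_iff mat_matrix_mult_nth sum_distrib_left sum.distrib algebra_simps)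
  have R0: "R0 = (\<Sum>j<d. mat (cnj (w0 j)) ** S j)" and R1: "R1 = (\<Sum>j<d. mat (cnj (w1 j)) ** S j)"
    unfolding comb sq w(3) w10 using n by auto
  have "R0 ** R1 = R1 ** R0"
  proof -
    have "S k ** R0 = R0 ** S k" if "k < d" for k
      unfolding R0 using commuting_tupleD[OF comm] that by (intro commute_sum commute_scale) auto
    then show ?thesis
      unfolding R1 by (intro commute_sum commute_scale) auto
  qed
  then have "commuting_tuple 2 R"
    by (auto simp: commuting_tuple_def R_def)
  moreover have "row_contractive 2 R"
    unfolding row_contractive_iff
  proof
    fix x
    have "ctranspose (S j) *v x = cnj (w0 j) *s (ctranspose R0 *v x) + cnj (w1 j) *s (ctranspose R1 *v x)" if "j < d" for j
    proof -
      have "ctranspose (S j) = mat (cnj (w0 j)) ** ctranspose R0 + mat (cnj (w1 j)) ** ctranspose R1"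
        unfolding S[OF that] by (simp add: vec_eq_iff mat_matrix_mult_nth)
      then show ?thesis
        by (simp add: matrix_vector_mult_add_rdistrib mat_vector_mult flip: matrix_vector_mul_assoc)
    qed
    then have "(\<Sum>j<d. (norm (ctranspose (S j) *v x))\<^sup>2)
        = (\<Sum>j<d. (norm (cnj (w0 j) *s (ctranspose R0 *v x) + cnj (w1 j) *s (ctranspose R1 *v x)))\<^sup>2)"
      by simp
    also have "\<dots> = n0 * (norm (ctranspose R0 *v x))\<^sup>2 + n1 * (norm (ctranspose R1 *v x))\<^sup>2"
      using w10 by (subst orthogonal_combination_norm) (simp_all add: n0_def n1_def mult.commute)
    also have "\<dots> = (norm (ctranspose R0 *v x))\<^sup>2 + (norm (ctranspose R1 *v x))\<^sup>2"
    proof -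
      have "ctranspose (0 :: complex^3^3) = 0" by (simp add: vec_eq_iff)
      then show ?thesis using n by auto
    qed
    finally have "(norm (ctranspose R0 *v x))\<^sup>2 + (norm (ctranspose R1 *v x))\<^sup>2 \<le> (norm x)\<^sup>2"
      using contr unfolding row_contractive_iff by metis
    then show "(\<Sum>j<2. (norm (ctranspose (R j) *v x))\<^sup>2) \<le> (norm x)\<^sup>2"
      by (simp add: R_def sum_lessThan_2)
  qed
  moreover have "R 0 $ 2 $ 1 = 0" "R 0 $ 3 $ 1 = 0" "R 1 $ 2 $ k = 0" "R 1 $ 3 $ k = 0" for k
    using pq by (simp_all add: R_def R0_def R1_def mat_matrix_mult_nth)
  moreover have "satisfies_vN d S C" if "satisfies_vN 2 R C"
  proof -
    have "satisfies_vN d (\<lambda>j. mat (w0 j) ** R 0 + mat (w1 j) ** R 1) C"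
    proof (rule satisfies_vN_polynomial_image[OF that \<open>commuting_tuple 2 R\<close> \<open>0 \<le> C\<close>])
      show "poly_eval_pair 2 (\<lambda>z. w0 j * z 0 + w1 j * z 1) (\<lambda>R. mat (w0 j) ** R 0 + mat (w1 j) ** R 1)" for j
        by (intro poly_eval_pair_add poly_eval_pair_mult poly_eval_pair_const poly_eval_pair_coordinate) auto
      show "(\<lambda>j. w0 j * z 0 + w1 j * z 1) \<in> unit_ball d" if "z \<in> unit_ball 2" for z
      proof -
        define e :: "complex^1" where "e = axis 1 1"
        have e: "norm (x *s e) = cmod x" for x by (simp add: norm_scale e_def)
        have eq: "w0 j *s (z 0 *s e) + w1 j *s (z 1 *s e) = (w0 j * z 0 + w1 j * z 1) *s e" for j
          by (simp add: vec_eq_iff algebra_simps)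
        have "(\<Sum>j<d. (cmod (w0 j * z 0 + w1 j * z 1))\<^sup>2)
            = n0 * (cmod (z 0))\<^sup>2 + n1 * (cmod (z 1))\<^sup>2"
          using orthogonal_combination_norm[OF w(3), of "z 0 *s e" "z 1 *s e"]
          unfolding eq e n0_def n1_def .
        also have "\<dots> \<le> 1 * (cmod (z 0))\<^sup>2 + 1 * (cmod (z 1))\<^sup>2"
          using n by (intro add_mono mult_right_mono) auto
        also have "\<dots> < 1" using that by (simp add: unit_ball_2)
        finally show ?thesis by (simp add: unit_ball_def)
      qed
    qed
    then show ?thesis
      using satisfies_vN_cong[of d S "\<lambda>j. mat (w0 j) ** R 0 + mat (w1 j) ** R 1" C] S by (simp add: R_def)
  qed
  ultimately show ?thesis by (rule that)
qed

section \<open>The best constants\<close>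

lemma upper_triangular_solve:
  fixes D S N :: "complex^3^3"
  assumes DS: "D ** S = N"
    and D: "D $ 2 $ 1 = 0" "D $ 3 $ 1 = 0" "D $ 3 $ 2 = 0" "\<And>i. D $ i $ i \<noteq> 0"
    and N: "N $ 2 $ 1 = 0" "N $ 3 $ 1 = 0" "N $ 3 $ 2 = 0" "N $ 2 $ 2 = 0"
  shows "S $ 2 $ 1 = 0" "S $ 3 $ 1 = 0" "S $ 3 $ 2 = 0" "S $ 2 $ 2 = 0"
proof -
  have entry: "N $ i $ k = D $ i $ 1 * S $ 1 $ k + D $ i $ 2 * S $ 2 $ k + D $ i $ 3 * S $ 3 $ k" for i k
    by (simp add: DS[symmetric] matrix_matrix_mult_def sum_3)
  show "S $ 3 $ 1 = 0" "S $ 3 $ 2 = 0"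
    using entry[of 3 1] entry[of 3 2] D N by auto
  then show "S $ 2 $ 1 = 0" "S $ 2 $ 2 = 0"
    using entry[of 2 1] entry[of 2 2] D N by auto
qed

text \<open>
  Each of the following moves transports bounds from the new tuple back to the old one: triangularize,
  shrink by a factor \<open>r < 1\<close> so that the tuple \<open>a\<close> of middle diagonal
  entries lies in the open ball, apply the automorphism that sends \<open>a\<close> to
  \<open>0\<close>, and compress to two variables.
\<close>

lemma reduction_to_pairs:
  fixes T :: "nat \<Rightarrow> complex^3^3"
  assumes comm: "commuting_tuple d T" and contr: "row_contractive d T" and "0 \<le> C"
    and pairs: "\<And>R :: nat \<Rightarrow> complex^3^3. commuting_tuple 2 R \<Longrightarrow> row_contractive 2 R \<Longrightarrow>
      R 0 $ 2 $ 1 = 0 \<Longrightarrow> R 0 $ 3 $ 1 = 0 \<Longrightarrow> (\<And>k. R 1 $ 2 $ k = 0) \<Longrightarrow> (\<And>k. R 1 $ 3 $ k = 0) \<Longrightarrow>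
      satisfies_vN 2 R C"
  shows "satisfies_vN d T C"
proof -
  obtain U :: "complex^3^3" where U: "ctranspose U ** U = mat 1" "U ** ctranspose U = mat 1"
    and tri: "\<And>j. j < d \<Longrightarrow> (ctranspose U ** T j ** U) $ 2 $ 1 = 0"
      "\<And>j. j < d \<Longrightarrow> (ctranspose U ** T j ** U) $ 3 $ 1 = 0"
      "\<And>j. j < d \<Longrightarrow> (ctranspose U ** T j ** U) $ 3 $ 2 = 0"
    by (rule unitary_triangularization[OF comm]) (rule that)
  define T' where "T' j = ctranspose U ** T j ** U" for j
  have conj_mult: "(ctranspose U ** A ** U) ** (ctranspose U ** B ** U) = ctranspose U ** (A ** B) ** U" for A B
  proof -
    have "(ctranspose U ** A ** U) ** (ctranspose U ** B ** U) = ctranspose U ** A ** (U ** ctranspose U) ** B ** U"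
      by (simp only: matrix_mul_assoc)
    then show ?thesis by (simp only: U matrix_mul_rid matrix_mul_assoc)
  qed
  have comm': "commuting_tuple d T'"
    using comm by (simp add: commuting_tuple_def T'_def conj_mult)
  have contr': "(\<Sum>j<d. (norm (ctranspose (T' j) *v x))\<^sup>2) \<le> (norm x)\<^sup>2" for x
  proof -
    have "norm (ctranspose (T' j) *v x) = norm (ctranspose (T j) *v (U *v x))" for j
    proof -
      have "ctranspose (T' j) *v x = ctranspose U *v (ctranspose (T j) *v (U *v x))"
        by (simp only: T'_def ctranspose_mult ctranspose_ctranspose matrix_vector_mul_assoc matrix_mul_assoc)
      then show ?thesis
        using norm_isometry_vector[of "ctranspose U"] U by simp
    qed
    then have "(\<Sum>j<d. (norm (ctranspose (T' j) *v x))\<^sup>2)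
        = (\<Sum>j<d. (norm (ctranspose (T j) *v (U *v x)))\<^sup>2)"
      by simp
    also have "\<dots> \<le> (norm (U *v x))\<^sup>2"
      using contr unfolding row_contractive_iff by blast
    also have "norm (U *v x) = norm x"
      by (rule norm_isometry_vector[OF U(1)])
    finally show ?thesis .
  qed
  have "satisfies_vN d (\<lambda>j. r *\<^sub>R T' j) C" if r: "0 \<le> r" "r < 1" for r
  proof -
    define V where "V j = r *\<^sub>R T' j" for j
    have V_tri: "V j $ 2 $ 1 = 0" "V j $ 3 $ 1 = 0" "V j $ 3 $ 2 = 0" if "j < d" for j
      using tri[OF that] by (simp_all add: V_def T'_def)
    have V_adj: "ctranspose (V j) *v x = r *\<^sub>R (ctranspose (T' j) *v x)" for j x
      by (simp add: V_def vec_eq_iff matrix_vector_mult_def scaleR_sum_right)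
    have V_sum: "(\<Sum>j<d. (norm (ctranspose (V j) *v x))\<^sup>2) \<le> r\<^sup>2 * (norm x)\<^sup>2" for x
      using mult_left_mono[OF contr'[of x], of "r\<^sup>2"] by (simp add: V_adj power_mult_distrib sum_distrib_left)
    have r2: "r\<^sup>2 < 1" using r by (simp add: power_less_one_iff)
    have V_contr: "row_contractive d V"
      unfolding row_contractive_iff
    proof
      fix x :: "complex^3"
      have "r\<^sup>2 * (norm x)\<^sup>2 \<le> 1 * (norm x)\<^sup>2" using r2 by (intro mult_right_mono) auto
      with V_sum[of x] show "(\<Sum>j<d. (norm (ctranspose (V j) *v x))\<^sup>2) \<le> (norm x)\<^sup>2" by simp
    qed
    have V_comm: "commuting_tuple d V"
      using comm' by (simp add: commuting_tuple_def V_def flip: mat_of_real_mult) (simp add: mat_mult_mat_mult)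
    define a where "a j = V j $ 2 $ 2" for j
    have a1: "(\<Sum>j<d. (cmod (a j))\<^sup>2) < 1"
    proof -
      have "cmod (a j) \<le> norm (ctranspose (V j) *v axis 2 1)" for j
        using Finite_Cartesian_Product.norm_nth_le[of "ctranspose (V j) *v axis 2 1" 2]
        by (simp add: ctranspose_axis_nth a_def)
      then have "(\<Sum>j<d. (cmod (a j))\<^sup>2) \<le> (\<Sum>j<d. (norm (ctranspose (V j) *v axis 2 1))\<^sup>2)"
        by (intro sum_mono power_mono) auto
      also have "\<dots> \<le> r\<^sup>2" using V_sum[of "axis 2 1"] by simp
      finally show ?thesis using r2 by simp
    qed
    define s where "s = sqrt (1 - (\<Sum>j<d. (cmod (a j))\<^sup>2))"
    have s: "s\<^sup>2 = 1 - (\<Sum>j<d. (cmod (a j))\<^sup>2)" "0 < s"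
      using a1 by (simp_all add: s_def)
    define A where "A = (\<Sum>k<d. mat (cnj (a k)) ** V k)"
    have A_nth: "A $ i $ k = (\<Sum>j<d. cnj (a j) * V j $ i $ k)" for i k
      by (simp add: A_def mat_matrix_mult_nth)
    obtain S where S: "commuting_tuple d S" "row_contractive d S"
      "\<And>j. j < d \<Longrightarrow> (mat 1 - (\<Sum>k<d. mat (cnj (a k)) ** V k)) ** S j = moebius_matrix d a s j V"
      "satisfies_vN d S C \<Longrightarrow> satisfies_vN d V C"
      by (rule satisfies_vN_moebius[OF V_comm V_contr s \<open>0 \<le> C\<close>]) (rule that)
    note S = S[folded A_def]
    have A_tri: "A $ 2 $ 1 = 0" "A $ 3 $ 1 = 0" "A $ 3 $ 2 = 0"
      by (simp_all add: A_nth V_tri)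
    have A_diag: "A $ i $ i \<noteq> 1" for i
    proof -
      have "cmod (A $ i $ i) \<le> norm (ctranspose A *v axis i 1)"
        using Finite_Cartesian_Product.norm_nth_le[of "ctranspose A *v axis i 1" i]
        by (simp add: ctranspose_axis_nth)
      also have "\<dots> \<le> sqrt (\<Sum>j<d. (cmod (a j))\<^sup>2)"
        using row_combination_bound[OF V_contr, of a "axis i 1"] by (simp add: A_def)
      also have "\<dots> < 1" using a1 by simp
      finally show ?thesis by auto
    qed
    have N_nth: "moebius_matrix d a s j V $ i $ k
        = a j * (mat 1 $ i $ k - of_real (1 / (1 + s)) * A $ i $ k) - of_real s * V j $ i $ k" for i j k
      unfolding moebius_matrix_def A_def[symmetric]
      by (simp only: vector_minus_component mat_matrix_mult_nth)
    have a_sum: "A $ 2 $ 2 = of_real (1 - s\<^sup>2)"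
    proof -
      have "A $ 2 $ 2 = of_real (\<Sum>j<d. (cmod (a j))\<^sup>2)"
        unfolding A_nth a_def[symmetric] by (simp add: mult.commute complex_norm_square del: of_real_power)
      then show ?thesis using s(1) by simp
    qed
    have middle: "moebius_matrix d a s j V $ 2 $ 2 = 0" for j
    proof -
      have "1 - 1 / (1 + s) * (1 - s\<^sup>2) - s = 0"
        using s(2) by (simp add: field_simps power2_eq_square)
      then have "complex_of_real (1 - 1 / (1 + s) * (1 - s\<^sup>2) - s) = 0"
        by (simp only: of_real_0)
      then have "a j * (1 - of_real (1 / (1 + s)) * of_real (1 - s\<^sup>2) - of_real s) = 0"
        by (simp only: of_real_diff of_real_mult of_real_1 mult_zero_right)
      then show ?thesis
        unfolding N_nth a_sum by (simp add: mat_def a_def[symmetric] right_diff_distrib mult.commute)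
    qed
    have S_tri: "S j $ 2 $ 1 = 0" "S j $ 3 $ 1 = 0" "S j $ 3 $ 2 = 0" "S j $ 2 $ 2 = 0" if "j < d" for j
    proof -
      have D: "(mat 1 - A) $ 2 $ 1 = 0" "(mat 1 - A) $ 3 $ 1 = 0" "(mat 1 - A) $ 3 $ 2 = 0"
        "(mat 1 - A) $ i $ i \<noteq> 0" for i
        using A_tri A_diag[of i] by (simp_all add: mat_def)
      have N: "moebius_matrix d a s j V $ 2 $ 1 = 0" "moebius_matrix d a s j V $ 3 $ 1 = 0"
        "moebius_matrix d a s j V $ 3 $ 2 = 0"
        unfolding N_nth using A_tri V_tri[OF that] by (simp_all add: mat_def)
      show "S j $ 2 $ 1 = 0" "S j $ 3 $ 1 = 0" "S j $ 3 $ 2 = 0" "S j $ 2 $ 2 = 0"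
        using upper_triangular_solve[OF S(3)[OF that] D N middle] by simp_all
    qed
    obtain R :: "nat \<Rightarrow> complex^3^3" where R: "commuting_tuple 2 R" "row_contractive 2 R"
      "R 0 $ 2 $ 1 = 0" "R 0 $ 3 $ 1 = 0" "\<And>k. R 1 $ 2 $ k = 0" "\<And>k. R 1 $ 3 $ k = 0"
      "satisfies_vN 2 R C \<Longrightarrow> satisfies_vN d S C"
      by (rule compression_to_pair[OF S(1,2) \<open>0 \<le> C\<close> S_tri]) (assumption, assumption, assumption, assumption, rule that)
    have "satisfies_vN 2 R C" by (rule pairs[OF R(1-6)])
    then have "satisfies_vN d V C" using R(7) S(4) by blast
    then show ?thesis unfolding V_def[abs_def] .
  qed
  then have "satisfies_vN d T' C" by (rule satisfies_vN_scale)
  then show ?thesis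
    unfolding T'_def by (rule satisfies_vN_unitary[OF U])
qed

lemma vN_bound_three: "vN_bound d TYPE(3) 3"
  unfolding vN_bound_iff
proof (intro allI impI, elim conjE)
  fix T :: "nat \<Rightarrow> complex^3^3" assume T: "commuting_tuple d T" "row_contractive d T"
  show "satisfies_vN d T 3"
  proof (rule reduction_to_pairs[OF T])
    fix R :: "nat \<Rightarrow> complex^3^3"
    assume R: "row_contractive 2 R" "R 0 $ 2 $ 1 = 0" "R 0 $ 3 $ 1 = 0"
      "\<And>k. R 1 $ 2 $ k = 0" "\<And>k. R 1 $ 3 $ k = 0"
    have "R 0 $ j $ 1 = 0" "R 1 $ j $ k = 0" if "j \<noteq> 1" for j k
      using exhaust_3[of j] that R(2-) by auto
    then show "satisfies_vN 2 R 3"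
      by (rule satisfies_vN_rank_one_row[OF R(1)])
  qed simp
qed

lemma vN_bound_from_2:
  assumes "vN_bound 2 TYPE(3) C" "0 \<le> C"
  shows "vN_bound d TYPE(3) C"
  unfolding vN_bound_iff
proof (intro allI impI, elim conjE)
  fix T :: "nat \<Rightarrow> complex^3^3" assume T: "commuting_tuple d T" "row_contractive d T"
  show "satisfies_vN d T C"
    by (rule reduction_to_pairs[OF T \<open>0 \<le> C\<close>]) (use assms(1) in \<open>auto simp: vN_bound_iff\<close>)
qed

text \<open>
  A pair can be padded by zeros, and a polynomial in two variables ignores the padding.
\<close>

lemma vN_bound_to_2:
  assumes "vN_bound d TYPE('n::finite) C" "0 \<le> C" "2 \<le> d"
  shows "vN_bound 2 TYPE('n) C"
  unfolding vN_bound_iff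
proof (intro allI impI, elim conjE)
  fix T :: "nat \<Rightarrow> complex^'n^'n" assume T: "commuting_tuple 2 T" "row_contractive 2 T"
  define T' where "T' j = (if j < 2 then T j else 0)" for j
  have zero: "0 ** A = 0" "A ** 0 = 0" "ctranspose 0 = 0" for A :: "complex^'n^'n"
    by (simp_all add: vec_eq_iff matrix_matrix_mult_def)
  have comm: "commuting_tuple d T'"
    using T(1) by (auto simp: commuting_tuple_def T'_def zero)
  have "row_contractive d T'"
    unfolding row_contractive_iff
  proof
    fix x
    have "(\<Sum>j<d. (norm (ctranspose (T' j) *v x))\<^sup>2) = (\<Sum>j<2. (norm (ctranspose (T j) *v x))\<^sup>2)"
      using \<open>2 \<le> d\<close> by (intro sum.mono_neutral_cong_right) (auto simp: T'_def zero)
    then show "(\<Sum>j<d. (norm (ctranspose (T' j) *v x))\<^sup>2) \<le> (norm x)\<^sup>2"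
      using T(2) by (simp add: row_contractive_iff)
  qed
  then have T': "satisfies_vN d T' C"
    using assms(1) comm by (simp add: vN_bound_iff)
  have "satisfies_vN 2 (\<lambda>j. T' j) C"
  proof (rule satisfies_vN_polynomial_image[OF T' comm \<open>0 \<le> C\<close>])
    show "poly_eval_pair d (\<lambda>z. z j) (\<lambda>T :: nat \<Rightarrow> complex^'n^'n. T j)" if "j < 2" for j
      using that \<open>2 \<le> d\<close> by (intro poly_eval_pair_coordinate) auto
    show "(\<lambda>j. z j) \<in> unit_ball 2" if "z \<in> unit_ball d" for z
    proof -
      have "(\<Sum>i<2. (cmod (z i))\<^sup>2) \<le> (\<Sum>i<d. (cmod (z i))\<^sup>2)"
        using \<open>2 \<le> d\<close> by (intro sum_mono2) auto
      then show ?thesis using that by (simp add: unit_ball_def)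
    qed
  qed
  moreover have "satisfies_vN 2 T C = satisfies_vN 2 T' C"
    by (rule satisfies_vN_cong) (simp add: T'_def)
  ultimately show "satisfies_vN 2 T C" by simp
qed

lemma norm_square_vec3: "(norm (x :: complex^3))\<^sup>2 = (cmod (x$1))\<^sup>2 + (cmod (x$2))\<^sup>2 + (cmod (x$3))\<^sup>2"
  by (simp add: norm_vec_def L2_set_def sum_3)

text \<open>
  For \<open>x\<^sup>2 + y\<^sup>2 \<le> 1\<close> one has \<open>16/25 x\<^sup>2 + 24/25 y \<le> 1 -
  (4/5 y - 3/5)\<^sup>2\<close>, so the polynomial is bounded by \<open>1\<close> on the ball. In
  its value at the pair the terms \<open>z\<^sup>2\<close> and \<open>w\<close> fall on the same
  corner entry and add up to \<open>16/25 \<cdot> 3/5 + 24/25 \<cdot> 4/5 = 1.152\<close>.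
\<close>

lemma vN_bound_lower:
  assumes "vN_bound 2 TYPE(3) C" "0 \<le> C"
  shows "1.152 \<le> C"
proof -
  define T :: "nat \<Rightarrow> complex^3^3" where
    "T j = (if j = 0 then vector [vector [0, 3/5, 0], vector [0, 0, 1], vector [0, 0, 0]]
            else vector [vector [0, 0, 4/5], vector [0, 0, 0], vector [0, 0, 0]])" for j
  have "T i ** T j = T j ** T i" if "i < 2" "j < 2" for i j
    using that by (auto simp: T_def vec_eq_iff forall_3 matrix_matrix_mult_def sum_3)
  then have comm: "commuting_tuple 2 T" by (simp add: commuting_tuple_def)
  have contr: "row_contractive 2 T"
    unfolding row_contractive_iff
  proof
    fix x
    have "(\<Sum>j<2. (norm (ctranspose (T j) *v x))\<^sup>2) = (cmod (x$1))\<^sup>2 + (cmod (x$2))\<^sup>2"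
      by (simp add: sum_lessThan_2 norm_square_vec3 matrix_vector_mult_def sum_3)
        (simp add: T_def norm_mult norm_divide power_mult_distrib power_divide)
    then show "(\<Sum>j<2. (norm (ctranspose (T j) *v x))\<^sup>2) \<le> (norm x)\<^sup>2"
      by (simp add: norm_square_vec3)
  qed
  have "poly_eval_pair 2 (\<lambda>z. 16/25 * (z 0 * z 0) + 24/25 * z 1)
      (\<lambda>T :: nat \<Rightarrow> complex^3^3. mat (16/25) ** (T 0 ** T 0) + mat (24/25) ** T 1)"
    by (intro poly_eval_pair_add poly_eval_pair_mult poly_eval_pair_const poly_eval_pair_coordinate) auto
  then obtain p where p: "p \<in> polys 2" "\<And>z. poly_at 2 p z = 16/25 * (z 0 * z 0) + 24/25 * z 1"
    "poly_at_mats 2 p T = mat (16/25) ** (T 0 ** T 0) + mat (24/25) ** T 1"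
    using comm unfolding poly_eval_pair_def by blast
  have "ball_sup 2 p \<le> 1"
  proof (rule ball_sup_le)
    fix z assume "z \<in> unit_ball 2"
    then have z: "(cmod (z 0))\<^sup>2 \<le> 1 - (cmod (z 1))\<^sup>2" by (simp add: unit_ball_2)
    have "cmod (poly_at 2 p z) \<le> 16/25 * (cmod (z 0))\<^sup>2 + 24/25 * cmod (z 1)"
      unfolding p(2) by (rule order_trans[OF norm_triangle_ineq]) (simp add: norm_mult norm_divide power2_eq_square)
    also have "\<dots> \<le> 16/25 * (1 - (cmod (z 1))\<^sup>2) + 24/25 * cmod (z 1)"
      using z by simp
    also have "\<dots> = 1 - (4/5 * cmod (z 1) - 3/5)\<^sup>2"
      by (simp add: power2_eq_square field_simps)
    also have "\<dots> \<le> 1" by simp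
    finally show "cmod (poly_at 2 p z) \<le> 1" .
  qed
  have "poly_at_mats 2 p T *v axis 3 1 = (1.152 :: complex) *s axis 1 1"
    unfolding p(3)
    by (simp add: vec_eq_iff forall_3 matrix_vector_mult_def sum_3 mat_matrix_mult_nth axis_def
        matrix_matrix_mult_def T_def) (simp add: mat_def)
  then have "norm (poly_at_mats 2 p T *v axis 3 1) = 1.152"
    by (simp add: norm_scale)
  then have "1.152 \<le> opnorm (poly_at_mats 2 p T)"
    using norm_matrix_vector_le[of "poly_at_mats 2 p T" "axis 3 1"] by simp
  also have "\<dots> \<le> C * ball_sup 2 p"
    using assms(1) comm contr p(1) by (auto simp: vN_bound_iff satisfies_vN_def)
  also have "\<dots> \<le> C * 1"
    using \<open>ball_sup 2 p \<le> 1\<close> \<open>0 \<le> C\<close> by (rule mult_left_mono)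
  finally show ?thesis by simp
qed

text \<open>
  Each instance of the inequality is a closed condition on the constant, so the infimum of all valid
  constants is valid and the least one exists.
\<close>

lemma vN_const_least:
  assumes "0 \<le> B" "vN_bound d TYPE('n::finite) B"
  shows "0 \<le> vN_const d TYPE('n)" "vN_bound d TYPE('n) (vN_const d TYPE('n))" "vN_const d TYPE('n) \<le> B"
proof -
  define X where "X = {C. 0 \<le> C \<and> vN_bound d TYPE('n) C}"
  have X: "B \<in> X" "bdd_below X"
    using assms by (auto simp: X_def intro: bdd_belowI[of _ 0])
  have "Inf X \<in> X"
  proof -
    have "opnorm (poly_at_mats d p T) \<le> Inf X * ball_sup d p"
      if T: "commuting_tuple d T" "row_contractive d T" and p: "p \<in> polys d" for T :: "nat \<Rightarrow> complex^'n^'n" and p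
    proof (cases "ball_sup d p = 0")
      case True
      have "opnorm (poly_at_mats d p T) \<le> B * ball_sup d p"
        using assms(2) T p by (auto simp: vN_bound_def)
      with True show ?thesis by simp
    next
      case False
      then have pos: "0 < ball_sup d p" using ball_sup_nonneg[of d p] by linarith
      have "opnorm (poly_at_mats d p T) / ball_sup d p \<le> Inf X"
        using X T p pos by (intro cInf_greatest) (auto simp: X_def vN_bound_def field_simps)
      then show ?thesis using pos by (simp add: field_simps)
    qed
    moreover have "0 \<le> Inf X"
      using X by (intro cInf_greatest) (auto simp: X_def)
    ultimately show ?thesis by (auto simp: X_def vN_bound_def)
  qed
  moreover have "vN_const d TYPE('n) = Inf X"
    unfolding vN_const_def
  proof (rule Least_equality)
    show "0 \<le> Inf X \<and> vN_bound d TYPE('n) (Inf X)"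
      using \<open>Inf X \<in> X\<close> by (simp add: X_def)
    show "Inf X \<le> C" if "0 \<le> C \<and> vN_bound d TYPE('n) C" for C
      using that X(2) by (intro cInf_lower) (auto simp: X_def)
  qed
  ultimately show "0 \<le> vN_const d TYPE('n)" "vN_bound d TYPE('n) (vN_const d TYPE('n))" "vN_const d TYPE('n) \<le> B"
    using X by (auto simp: X_def intro: cInf_lower)
qed

theorem theorem1p2:
  fixes d :: nat
  assumes "d \<ge> 2"
  shows "vN_const d TYPE(3) = vN_const 2 TYPE(3)
    \<and> 1.11767 \<le> vN_const d TYPE(3) \<and> vN_const d TYPE(3) \<le> 3.14626"
proof -
  have "(0 \<le> C \<and> vN_bound d TYPE(3) C) = (0 \<le> C \<and> vN_bound 2 TYPE(3) C)" for C
    using vN_bound_from_2 vN_bound_to_2[OF _ _ assms] by blast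
  then have eq: "vN_const d TYPE(3) = vN_const 2 TYPE(3)"
    unfolding vN_const_def by simp
  have "1.152 \<le> vN_const 2 TYPE(3)" "vN_const 2 TYPE(3) \<le> 3"
    using vN_const_least[OF _ vN_bound_three, of 2] vN_bound_lower by simp_all
  then show ?thesis
    unfolding eq by simp
qed

end
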